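(* Let $G=(V,E)$ be an arbitrary undirected graph with $n$ vertices and $m$ edges that contains, as a Hamiltonian path, the true order $x_1\prec\cdots\prec x_n$ of its vertices (i.e., $(x_i,x_{i+1})\in E$ for all $i$). The algorithm SparseGeneralizedSort (defined in the context) makes at most $O(\sqrt{mn}\,\log n)$ queries and identifies the true order of the vertices with high probability.
   Context: A query of an edge $(u,v)\in E$ reveals which of $u,v$ precedes the other; only edges of $E$ may be queried. For a set $E'$ of already-queried (hence directed) edges, a permutation $\sigma$ of $V$ is compatible with $G,E'$ if $u$ precedes $v$ in $\sigma$ for every directed $(u,v)\in E'$; $\Sigma(G,E')$ is the set of compatible permutations, and $S_{E',G}(u)$ is the average rank of $u$ over all $\sigma\in\Sigma(G,E')$. PredictionSort$(G,\tilde E,w)$ denotes a (previously known) randomized procedure that, given $G$, an orientation $\tilde E$ of $E$ in which at most $w$ edge directions differ from the true orientation, and $w$, uses $O(w+n\log n)$ queries and determines the true orientation of all edges with high probability. SparseGeneralizedSort: set $a=(1+c)\sqrt{m/n}$ for a sufficiently large constant $c>0$ and $w=\sqrt{m/n}\cdot\log n$; start with $E'=\emptyset$ and repeat: (1) if $|\Sigma(G,E')|=1$, return its unique permutation; (2) let $\sigma$ order the vertices by nondecreasing $S_{E',G}(\cdot)$ (ties broken arbitrarily), and let $\tilde E$ orient each edge $(u,v)$ as $u\to v$ iff $u$ precedes $v$ in $\sigma$; (3) query $a$ uniformly random edges of $E$; (4) if all of them agree with $\tilde E$, return the output of PredictionSort$(G,\tilde E,w)$; otherwise add the mispredicted edges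 with their true directions to $E'$ and repeat.
   Formalization: The algorithm's parameter w is taken to be sqrt(mn)·log n instead of the stated sqrt(m/n)·log n; with the stated value the claim fails (e.g. on a path, a bad prediction passes the test with constant probability and PredictionSort is called outside its promise). *)

theory Defs
  imports
    "HOL-Probability.Probability"
    "HOL-Probability.SPMF"
    "HOL-Combinatorics.Multiset_Permutations"
begin

section \<open>Randomized algorithms with edge queries\<close>

text \<open>
  An undirected edge is a two-element set of vertices, a directed edge a pair. Querying
  an undirected edge returns its true directed version. An algorithm is a tree of queries and
  random choices, so it has no access to the true order other than its queries.
\<close>

datatype ('v, 'r) query_alg =
    Return 'r
  | Query "'v set" "'v \<times> 'v \<Rightarrow> ('v, 'r) query_alg"
  | Random "('v, 'r) query_alg pmf"

primrec bind_alg ::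
    "('v, 'r) query_alg \<Rightarrow> ('r \<Rightarrow> ('v, 's) query_alg) \<Rightarrow> ('v, 's) query_alg" where
  "bind_alg (Return r) k = k r"
| "bind_alg (Query e f) k = Query e (\<lambda>b. bind_alg (f b) k)"
| "bind_alg (Random p) k = Random (map_pmf (\<lambda>x. bind_alg x k) p)"

primrec query_all :: "'v set list \<Rightarrow> ('v, ('v \<times> 'v) list) query_alg" where
  "query_all [] = Return []"
| "query_all (e # es) = Query e (\<lambda>b. bind_alg (query_all es) (\<lambda>bs. Return (b # bs)))"

text \<open>The joint distribution of the result and the number of queries made.\<close>

primrec run :: "('v set \<Rightarrow> 'v \<times> 'v) \<Rightarrow> ('v, 'r) query_alg \<Rightarrow> ('r \<times> nat) pmf" where
  "run \<O> (Return r) = return_pmf (r, 0)"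
| "run \<O> (Query e f) = map_pmf (\<lambda>(r, q). (r, Suc q)) (run \<O> (f (\<O> e)))"
| "run \<O> (Random p) = join_pmf (map_pmf (run \<O>) p)"

inductive queries_within :: "'v set set \<Rightarrow> ('v, 'r) query_alg \<Rightarrow> bool" for E where
  "queries_within E (Return r)"
| "e \<in> E \<Longrightarrow> (\<And>b. queries_within E (f b)) \<Longrightarrow> queries_within E (Query e f)"
| "(\<And>x. x \<in> set_pmf p \<Longrightarrow> queries_within E x) \<Longrightarrow> queries_within E (Random p)"

text \<open>
  Unbounded repetition of a round that either ends with a result (\<^const>\<open>Inl\<close>) or hands a new
  state to the next round (\<^const>\<open>Inr\<close>); query counts add up. Non-termination would show up as
  missing probability mass.
\<close>

partial_function (spmf) run_rounds ::
    "('v set \<Rightarrow> 'v \<times> 'v) \<Rightarrow> ('s \<Rightarrow> ('v, 'r + 's) query_alg) \<Rightarrow> 's \<Rightarrow> ('r \<times> nat) spmf" where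
  "run_rounds \<O> rnd s =
     bind_spmf (spmf_of_pmf (run \<O> (rnd s))) (\<lambda>(x, q).
       case x of
         Inl r \<Rightarrow> return_spmf (r, q)
       | Inr s' \<Rightarrow> map_spmf (\<lambda>(r, q'). (r, q + q')) (run_rounds \<O> rnd s'))"


section \<open>Generalized sorting\<close>

text \<open>A permutation of the vertices is a distinct list enumerating them; ranks start at 1.\<close>

definition vrank :: "'v list \<Rightarrow> 'v \<Rightarrow> nat" where
  "vrank \<sigma> u = Suc (length (takeWhile (\<lambda>x. x \<noteq> u) \<sigma>))"

definition precedes :: "'v list \<Rightarrow> 'v \<Rightarrow> 'v \<Rightarrow> bool" where
  "precedes \<sigma> u v \<longleftrightarrow> vrank \<sigma> u < vrank \<sigma> v"

definition sorting_instance :: "'v set \<Rightarrow> 'v set set \<Rightarrow> 'v list \<Rightarrow> bool" where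
  "sorting_instance V E xs \<longleftrightarrow>
     finite V \<and> V \<noteq> {} \<and> (\<forall>e\<in>E. e \<subseteq> V \<and> card e = 2) \<and>
     xs \<in> permutations_of_set V \<and>
     (\<forall>i. Suc i < length xs \<longrightarrow> {xs ! i, xs ! Suc i} \<in> E)"

definition is_orientation :: "'v set set \<Rightarrow> ('v \<times> 'v) set \<Rightarrow> bool" where
  "is_orientation E D \<longleftrightarrow>
     (\<forall>(u, v)\<in>D. {u, v} \<in> E) \<and> (\<forall>u v. {u, v} \<in> E \<longrightarrow> ((u, v) \<in> D \<longleftrightarrow> (v, u) \<notin> D))"

definition orient_by :: "'v list \<Rightarrow> 'v set set \<Rightarrow> ('v \<times> 'v) set" where
  "orient_by \<sigma> E = {(u, v). {u, v} \<in> E \<and> precedes \<sigma> u v}"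

definition order_oracle :: "'v list \<Rightarrow> 'v set \<Rightarrow> 'v \<times> 'v" where
  "order_oracle xs e = (THE p. e = {fst p, snd p} \<and> precedes xs (fst p) (snd p))"

definition compatible :: "'v set \<Rightarrow> ('v \<times> 'v) set \<Rightarrow> 'v list set" where
  "compatible V E' = {\<sigma> \<in> permutations_of_set V. \<forall>(u, v)\<in>E'. precedes \<sigma> u v}"

definition avg_rank :: "'v set \<Rightarrow> ('v \<times> 'v) set \<Rightarrow> 'v \<Rightarrow> real" where
  "avg_rank V E' u =
     (\<Sum>\<sigma>\<in>compatible V E'. real (vrank \<sigma> u)) / real (card (compatible V E'))"

text \<open>
  An arbitrary rule for breaking ties is a function choosing, for each set of directed edges,
  one of the vertex orders with nondecreasing average rank.
\<close>

definition is_avg_rank_order :: "'v set \<Rightarrow> (('v \<times> 'v) set \<Rightarrow> 'v list) \<Rightarrow> bool" where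
  "is_avg_rank_order V ord \<longleftrightarrow>
     (\<forall>E'. ord E' \<in> permutations_of_set V \<and> sorted (map (avg_rank V E') (ord E')))"


section \<open>Sorting with predictions as a black box\<close>

type_synonym 'v prediction_alg =
  "'v set \<Rightarrow> 'v set set \<Rightarrow> ('v \<times> 'v) set \<Rightarrow> real \<Rightarrow> ('v, ('v \<times> 'v) set) query_alg"

text \<open>
  With high probability means with probability \<open>1 - O(n\<^sup>-\<^sup>d)\<close>. The constants \<open>K\<close> and \<open>C\<close>
  are those of the query bound and of the failure probability.
\<close>

definition prediction_sort :: "real \<Rightarrow> real \<Rightarrow> real \<Rightarrow> 'v prediction_alg \<Rightarrow> bool" where
  "prediction_sort d K C PS \<longleftrightarrow>
     (\<forall>V E xs D w. sorting_instance V E xs \<longrightarrow> is_orientation E D \<longrightarrow>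
        real (card (D - orient_by xs E)) \<le> w \<longrightarrow>
        queries_within E (PS V E D w) \<and>
        measure_pmf.prob (run (order_oracle xs) (PS V E D w))
          {(D', q). D' = orient_by xs E \<and>
             real q \<le> K * (w + real (card V) * ln (real (card V)))}
        \<ge> 1 - C * real (card V) powr (- d))"

text \<open>
  The query bound as a budget, respected in every run and even if more than \<open>w\<close> of the edge
  directions are wrong.
\<close>

definition within_query_budget :: "real \<Rightarrow> 'v prediction_alg \<Rightarrow> bool" where
  "within_query_budget K PS \<longleftrightarrow>
     (\<forall>V E xs D w. sorting_instance V E xs \<longrightarrow> is_orientation E D \<longrightarrow> 0 \<le> w \<longrightarrow>
        (\<forall>(D', q) \<in> set_pmf (run (order_oracle xs) (PS V E D w)).
           real q \<le> K * (w + real (card V) * ln (real (card V)))))"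


section \<open>The algorithm\<close>

text \<open>
  The \<open>a\<close> random edges are drawn independently, with replacement. The parameter \<open>w\<close> is
  \<open>sqrt (m n) log n\<close>: an orientation with more than \<open>w\<close> wrong edges passes the test with
  probability at most \<open>(1 - w / m)\<^sup>a \<le> n powr (- (1 + c))\<close>. (With \<open>sqrt (m / n) log n\<close> in its
  place, the test would not ensure the precondition of the prediction algorithm.)
  The prediction algorithm outputs an orientation of all edges, from which the algorithm reads
  off the vertex order as the unique compatible permutation.
\<close>

definition sparse_sort_round ::
    "real \<Rightarrow> 'v prediction_alg \<Rightarrow> (('v \<times> 'v) set \<Rightarrow> 'v list) \<Rightarrow> 'v set \<Rightarrow> 'v set set \<Rightarrow>
     ('v \<times> 'v) set \<Rightarrow> ('v, 'v list + ('v \<times> 'v) set) query_alg" where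
  "sparse_sort_round c PS ord V E E' =
     (let n = real (card V);
          m = real (card E);
          a = nat \<lceil>(1 + c) * sqrt (m / n)\<rceil>;
          w = sqrt (m * n) * ln n;
          \<sigma> = ord E';
          P = orient_by \<sigma> E
      in if card (compatible V E') = 1 then Return (Inl (the_elem (compatible V E')))
         else Random (map_pmf (\<lambda>es.
                bind_alg (query_all es) (\<lambda>answers.
                  if set answers \<subseteq> P
                  then bind_alg (PS V E P w) (\<lambda>D. Return (Inl (the_elem (compatible V D))))
                  else Return (Inr (E' \<union> (set answers - P)))))
              (replicate_pmf a (pmf_of_set E))))"

definition sparse_generalized_sort ::
    "real \<Rightarrow> 'v prediction_alg \<Rightarrow> (('v \<times> 'v) set \<Rightarrow> 'v list) \<Rightarrow> 'v set \<Rightarrow> 'v set set \<Rightarrow>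
     ('v set \<Rightarrow> 'v \<times> 'v) \<Rightarrow> ('v list \<times> nat) spmf" where
  "sparse_generalized_sort c PS ord V E \<O> =
     run_rounds \<O> (sparse_sort_round c PS ord V E) {}"

end

theory Submission
  imports Defs "HOL-Real_Asymp.Real_Asymp"
begin

text \<open>
  A mispredicted edge cuts the number of compatible permutations by a constant factor: if \<open>u\<close> has
  average rank at most that of \<open>v\<close>, then \<open>u\<close> precedes \<open>v\<close> in at least a quarter of them. As in
  Kahn and Linial's argument, this comes from log-concavity. Give the cone of positive vectors
  \<open>x\<close> that respect the partial order the density \<open>exp (- Max x)\<close>. Each compatible permutation
  is a subcone of mass 1 on which \<open>x u\<close> has mean the rank of \<open>u\<close>, so \<open>X = x v - x u\<close> has
  nonnegative mean, and by the Prekopa-Leindler inequality its tail is log-concave. If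
  \<open>X \<ge> 0\<close> had probability \<open>p < 1/4\<close>, the tail would decay geometrically, too fast for the
  positive part of \<open>X\<close> to balance the negative part.

  Hence every run has at most \<open>O(n ln n)\<close> rounds of \<open>O(sqrt (m / n))\<close> queries each. A round
  accepts an orientation with more than \<open>w\<close> wrong edges with probability at most
  \<open>n powr - (1 + c)\<close>, so a union bound over the rounds leaves essentially the failure probability
  of the one call of the prediction algorithm.
\<close>

section \<open>The Prekopa-Leindler inequality\<close>

lemma emeasure_midpoint_set_ge:
  fixes A B C :: "real set"
  assumes [measurable]: "A \<in> sets borel" "B \<in> sets borel" "C \<in> sets borel"
    and ne: "A \<noteq> {}" "B \<noteq> {}" and bd: "bounded A" "bounded B"
    and C: "\<And>a b. a \<in> A \<Longrightarrow> b \<in> B \<Longrightarrow> (a + b) / 2 \<in> C"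
  shows "emeasure lborel A + emeasure lborel B \<le> 2 * emeasure lborel C"
proof (rule ennreal_le_epsilon)
  fix e :: real assume e: "0 < e"
  note bdd = bounded_imp_bdd_above[OF bd(1)] bounded_imp_bdd_below[OF bd(2)]
  obtain a where a: "a \<in> A" "Sup A - e / 2 < a"
    using less_cSupD[OF ne(1), of "Sup A - e / 2"] e by auto
  obtain b where b: "b \<in> B" "b < Inf B + e / 2"
    using cInf_lessD[OF ne(2), of "Inf B + e / 2"] e by auto
  define J where "J = {(a + Inf B) / 2 .. (Sup A + b) / 2}"
  have J: "emeasure lborel J \<le> ennreal (e / 2)"
    using a b e by (cases "(a + Inf B) / 2 \<le> (Sup A + b) / 2") (auto simp: J_def field_simps intro!: ennreal_leI)
  have pointwise: "indicator A (- b + 2 * x) + indicator B (- a + 2 * x)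
      \<le> (indicator C x + indicator J x :: ennreal)" for x
  proof -
    have "x \<in> C \<and> x \<le> (Sup A + b) / 2" if "- b + 2 * x \<in> A"
      using C[OF that b(1)] cSup_upper[OF that bdd(1)] by (auto simp: field_simps)
    moreover have "x \<in> C \<and> (a + Inf B) / 2 \<le> x" if "- a + 2 * x \<in> B"
      using C[OF a(1) that] cInf_lower[OF that bdd(2)] by (auto simp: field_simps)
    ultimately show ?thesis by (auto simp: indicator_def J_def)
  qed
  have [measurable]: "J \<in> sets borel" by (simp add: J_def)
  have "emeasure lborel A + emeasure lborel B
      = (\<integral>\<^sup>+x. indicator A x \<partial>lborel) + (\<integral>\<^sup>+x. indicator B x \<partial>lborel)" by simp
  also have "\<dots> = 2 * (\<integral>\<^sup>+x. indicator A (- b + 2 * x) \<partial>lborel)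
      + 2 * (\<integral>\<^sup>+x. indicator B (- a + 2 * x) \<partial>lborel)"
    by (subst nn_integral_real_affine[where c = 2 and t = "- b"], simp, simp,
        subst nn_integral_real_affine[where c = 2 and t = "- a" and f = "indicator B"], simp, simp) simp
  also have "\<dots> = 2 * (\<integral>\<^sup>+x. indicator A (- b + 2 * x) + indicator B (- a + 2 * x) \<partial>lborel)"
    by (subst nn_integral_add) (auto simp: distrib_left)
  also have "\<dots> \<le> 2 * (\<integral>\<^sup>+x. indicator C x + indicator J x \<partial>lborel)"
    by (intro mult_left_mono nn_integral_mono pointwise) auto
  also have "\<dots> = 2 * emeasure lborel C + 2 * emeasure lborel J"
    by (subst nn_integral_add) (auto simp: distrib_left)
  also have "\<dots> \<le> 2 * emeasure lborel C + 2 * ennreal (e / 2)"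
    by (intro add_left_mono mult_left_mono J) auto
  also have "2 * ennreal (e / 2) = ennreal e"
    by (metis ennreal_mult' ennreal_numeral nonzero_mult_div_cancel_left times_divide_eq_right zero_le_numeral zero_neq_numeral)
  finally show "emeasure lborel A + emeasure lborel B \<le> 2 * emeasure lborel C + ennreal e" .
qed

lemma nn_integral_eq_integral_superlevel:
  fixes F :: "real \<Rightarrow> real"
  assumes [measurable]: "F \<in> borel_measurable borel" and F: "\<And>x. 0 \<le> F x" "\<And>x. F x \<le> 1"
  shows "(\<integral>\<^sup>+x. ennreal (F x) \<partial>lborel)
    = (\<integral>\<^sup>+s. indicator {0<..<1} s * emeasure lborel {x. s < F x} \<partial>lborel)"
proof -
  have *: "ennreal (F x) = (\<integral>\<^sup>+s. indicator {0<..<1} s * indicator {x. s < F x} x \<partial>lborel)" for x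
  proof -
    have "(\<integral>\<^sup>+s. indicator {0<..<1} s * indicator {x. s < F x} x \<partial>lborel)
        = (\<integral>\<^sup>+s. indicator {0<..<F x} s \<partial>lborel)"
      using F[of x] by (intro nn_integral_cong) (auto simp: indicator_def)
    then show ?thesis using F[of x] by simp
  qed
  have "(\<integral>\<^sup>+x. ennreal (F x) \<partial>lborel)
      = (\<integral>\<^sup>+x. \<integral>\<^sup>+s. indicator {0<..<1} s * indicator {x. s < F x} x \<partial>lborel \<partial>lborel)"
    by (simp add: *)
  also have "\<dots> = (\<integral>\<^sup>+s. \<integral>\<^sup>+x. indicator {0<..<1} s * indicator {x. s < F x} x \<partial>lborel \<partial>lborel)"
    by (rule lborel_pair.Fubini') (simp add: indicator_def[abs_def])
  also have "\<dots> = (\<integral>\<^sup>+s. indicator {0<..<1} s * emeasure lborel {x. s < F x} \<partial>lborel)"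
    by (intro nn_integral_cong) (simp add: nn_integral_cmult)
  finally show ?thesis .
qed

lemma Prekopa_Leindler_normalized:
  fixes f g :: "real \<Rightarrow> real" and h :: "real \<Rightarrow> ennreal"
  assumes [measurable]: "f \<in> borel_measurable borel" "g \<in> borel_measurable borel" "h \<in> borel_measurable borel"
    and f: "\<And>x. 0 \<le> f x" "\<And>x. f x \<le> 1" "\<And>s. s < 1 \<Longrightarrow> \<exists>x. s < f x" "bounded {x. f x \<noteq> 0}"
    and g: "\<And>x. 0 \<le> g x" "\<And>x. g x \<le> 1" "\<And>s. s < 1 \<Longrightarrow> \<exists>x. s < g x" "bounded {x. g x \<noteq> 0}"
    and h: "\<And>x y. ennreal (f x * g y) \<le> (h ((x + y) / 2))\<^sup>2"
  shows "(\<integral>\<^sup>+x. f x \<partial>lborel) + (\<integral>\<^sup>+x. g x \<partial>lborel) \<le> 2 * (\<integral>\<^sup>+x. h x \<partial>lborel)"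
proof -
  define k where "k x = enn2real (min 1 (h x))" for x
  have [measurable]: "k \<in> borel_measurable borel" by (simp add: k_def[abs_def])
  have ek: "ennreal (k x) = min 1 (h x)" for x
    unfolding k_def by (rule ennreal_enn2real) (simp add: min_less_iff_disj)
  have k: "0 \<le> k x" "k x \<le> 1" for x
  proof -
    show "0 \<le> k x" by (simp add: k_def)
    have "ennreal (k x) \<le> ennreal 1" by (simp add: ek)
    then show "k x \<le> 1" by (subst (asm) ennreal_le_iff) auto
  qed
  have level: "indicator {0<..<1} s * emeasure lborel {x. s < f x} + indicator {0<..<1} s * emeasure lborel {x. s < g x}
      \<le> 2 * (indicator {0<..<1} s * emeasure lborel {x. s < k x})" for s :: real
  proof (cases "s \<in> {0<..<1}")
    case True
    have "(x + y) / 2 \<in> {x. s < k x}" if "s < f x" "s < g y" for x y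
    proof -
      have "(ennreal s)\<^sup>2 = ennreal (s * s)"
        using True by (simp add: power2_eq_square ennreal_mult)
      also have "\<dots> < ennreal (f x * g y)"
        using that True by (intro ennreal_lessI mult_strict_mono mult_pos_pos) auto
      also have "\<dots> \<le> (h ((x + y) / 2))\<^sup>2" by (rule h)
      finally have "ennreal s < h ((x + y) / 2)"
        by (metis linorder_not_le power_mono zero_le)
      moreover have "ennreal s < 1" using True by (simp add: ennreal_less_one_iff)
      ultimately have "ennreal s < ennreal (k ((x + y) / 2))" by (simp add: ek)
      then show ?thesis using True by (simp add: ennreal_less_iff)
    qed
    moreover have "bounded {x. s < f x}" "bounded {x. s < g x}"
      using True by (auto intro: bounded_subset[OF f(4)] bounded_subset[OF g(4)])
    moreover have "{x. s < f x} \<noteq> {}" "{x. s < g x} \<noteq> {}" using f(3)[of s] g(3)[of s] True by auto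
    ultimately have "emeasure lborel {x. s < f x} + emeasure lborel {x. s < g x}
        \<le> 2 * emeasure lborel {x. s < k x}"
      by (intro emeasure_midpoint_set_ge) auto
    then show ?thesis using True by simp
  qed simp
  have "(\<integral>\<^sup>+x. f x \<partial>lborel) + (\<integral>\<^sup>+x. g x \<partial>lborel) =
      (\<integral>\<^sup>+s. indicator {0<..<1} s * emeasure lborel {x. s < f x}
        + indicator {0<..<1} s * emeasure lborel {x. s < g x} \<partial>lborel)"
    using f g by (subst (1 2) nn_integral_eq_integral_superlevel) (auto simp: nn_integral_add)
  also have "\<dots> \<le> (\<integral>\<^sup>+s. 2 * (indicator {0<..<1} s * emeasure lborel {x. s < k x}) \<partial>lborel)"
    by (intro nn_integral_mono level)
  also have "\<dots> = 2 * (\<integral>\<^sup>+x. k x \<partial>lborel)"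
    using k by (subst nn_integral_eq_integral_superlevel) (auto simp: nn_integral_cmult)
  also have "\<dots> \<le> 2 * (\<integral>\<^sup>+x. h x \<partial>lborel)"
    by (intro mult_left_mono nn_integral_mono) (auto simp: ek)
  finally show ?thesis .
qed

lemma ennreal_arith_geo_mean: "4 * (x * y) \<le> (x + y :: ennreal)\<^sup>2"
proof (cases "x = top \<or> y = top")
  case False
  then obtain a b where ab: "0 \<le> a" "x = ennreal a" "0 \<le> b" "y = ennreal b"
    by (metis ennreal_cases)
  have "4 * (a * b) \<le> (a + b)\<^sup>2"
    using zero_le_power2[of "a - b"] by (simp add: power2_eq_square algebra_simps)
  then have "ennreal (4 * (a * b)) \<le> ennreal ((a + b)\<^sup>2)" by (rule ennreal_leI)
  then show ?thesis using ab by (simp add: ennreal_mult ennreal_power flip: ennreal_plus)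
qed (auto simp: power2_eq_square ennreal_top_mult ennreal_mult_top)

lemma Prekopa_Leindler_bounded:
  fixes f g :: "real \<Rightarrow> real" and h :: "real \<Rightarrow> ennreal"
  assumes [measurable]: "f \<in> borel_measurable borel" "g \<in> borel_measurable borel" "h \<in> borel_measurable borel"
    and f: "\<And>x. 0 \<le> f x" "\<And>x. f x \<le> M" "bounded {x. f x \<noteq> 0}"
    and g: "\<And>x. 0 \<le> g x" "\<And>x. g x \<le> N" "bounded {x. g x \<noteq> 0}"
    and h: "\<And>x y. ennreal (f x * g y) \<le> (h ((x + y) / 2))\<^sup>2"
  shows "(\<integral>\<^sup>+x. f x \<partial>lborel) * (\<integral>\<^sup>+x. g x \<partial>lborel) \<le> (\<integral>\<^sup>+x. h x \<partial>lborel)\<^sup>2"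
proof (cases "(\<forall>x. f x = 0) \<or> (\<forall>x. g x = 0)")
  case False
  define A B where "A = Sup (range f)" and "B = Sup (range g)"
  have bdd: "bdd_above (range f)" "bdd_above (range g)" using f(2) g(2) by (auto intro!: bdd_aboveI)
  have fA: "f x \<le> A" and gB: "g x \<le> B" for x
    unfolding A_def B_def using bdd by (auto intro: cSup_upper)
  have AB: "A > 0" "B > 0"
    using False f(1) g(1) fA gB by (metis less_eq_real_def order_trans not_le)+
  define c where "c = sqrt (A * B)"
  have c: "c > 0" "c\<^sup>2 = A * B" using AB by (auto simp: c_def)
  have ex: "\<exists>x. s < f x / A" "\<exists>x. s < g x / B" if "s < 1" for s
    using less_cSupD[of "range f" "s * A"] less_cSupD[of "range g" "s * B"] that AB
    by (auto simp: A_def[symmetric] B_def[symmetric] field_simps)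
  have "(\<integral>\<^sup>+x. f x / A \<partial>lborel) + (\<integral>\<^sup>+x. g x / B \<partial>lborel) \<le> 2 * (\<integral>\<^sup>+x. ennreal (1 / c) * h x \<partial>lborel)"
  proof (rule Prekopa_Leindler_normalized)
    fix x y
    have "ennreal (f x / A * (g y / B)) = ennreal ((1 / c)\<^sup>2) * ennreal (f x * g y)"
      using f(1) g(1) AB c by (subst ennreal_mult[symmetric]) (auto simp: field_simps power_divide)
    also have "\<dots> \<le> ennreal ((1 / c)\<^sup>2) * (h ((x + y) / 2))\<^sup>2" by (intro mult_left_mono h) auto
    also have "\<dots> = (ennreal (1 / c) * h ((x + y) / 2))\<^sup>2"
      using c by (simp add: power_mult_distrib ennreal_power)
    finally show "ennreal (f x / A * (g y / B)) \<le> (ennreal (1 / c) * h ((x + y) / 2))\<^sup>2" .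
  qed (use f g fA gB AB ex in auto)
  then have le: "(\<integral>\<^sup>+x. f x / A \<partial>lborel) + (\<integral>\<^sup>+x. g x / B \<partial>lborel) \<le> 2 * (ennreal (1 / c) * (\<integral>\<^sup>+x. h x \<partial>lborel))"
    by (simp add: nn_integral_cmult)
  have scale: "(\<integral>\<^sup>+x. ennreal (u x) \<partial>lborel) = ennreal U * (\<integral>\<^sup>+x. u x / U \<partial>lborel)"
    if "U > 0" "u \<in> borel_measurable borel" "\<And>x. 0 \<le> u x" for u :: "real \<Rightarrow> real" and U
    using that by (subst nn_integral_cmult[symmetric]) (auto simp: ennreal_mult[symmetric])
  have "4 * ((\<integral>\<^sup>+x. f x \<partial>lborel) * (\<integral>\<^sup>+x. g x \<partial>lborel))
      = ennreal (A * B) * (4 * ((\<integral>\<^sup>+x. f x / A \<partial>lborel) * (\<integral>\<^sup>+x. g x / B \<partial>lborel)))"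
    using AB f g by (subst scale[of A f], simp, simp, simp, subst scale[of B g]) (auto simp: ennreal_mult ac_simps)
  also have "\<dots> \<le> ennreal (A * B) * (2 * (ennreal (1 / c) * (\<integral>\<^sup>+x. h x \<partial>lborel)))\<^sup>2"
    by (intro mult_left_mono order_trans[OF ennreal_arith_geo_mean] power_mono le) auto
  also have "\<dots> = 4 * ((ennreal c * ennreal (1 / c)) * (\<integral>\<^sup>+x. h x \<partial>lborel))\<^sup>2"
    using c by (simp add: c(2)[symmetric] power_mult_distrib ennreal_power[symmetric] ac_simps)
  also have "ennreal c * ennreal (1 / c) = 1" using c by (simp add: ennreal_mult[symmetric])
  finally show ?thesis by (simp add: ennreal_mult_le_mult_iff)
qed auto

lemma Prekopa_Leindler_real:
  fixes f g h :: "real \<Rightarrow> ennreal"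
  assumes [measurable]: "f \<in> borel_measurable borel" "g \<in> borel_measurable borel" "h \<in> borel_measurable borel"
    and h: "\<And>x y. f x * g y \<le> (h ((x + y) / 2))\<^sup>2"
  shows "(\<integral>\<^sup>+x. f x \<partial>lborel) * (\<integral>\<^sup>+x. g x \<partial>lborel) \<le> (\<integral>\<^sup>+x. h x \<partial>lborel)\<^sup>2"
proof -
  define trunc :: "(real \<Rightarrow> ennreal) \<Rightarrow> nat \<Rightarrow> real \<Rightarrow> real"
    where "trunc u n x = enn2real (min (of_nat n) (u x)) * indicator {- real n..real n} x" for u n x
  have [measurable]: "trunc u n \<in> borel_measurable borel" if "u \<in> borel_measurable borel" for u n
    using that by (simp add: trunc_def[abs_def])
  have et: "ennreal (trunc u n x) = min (of_nat n) (u x) * indicator {- real n..real n} x" for u n x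
    unfolding trunc_def
    by (subst ennreal_mult) (auto simp: indicator_def min_less_iff_disj of_nat_less_top intro!: ennreal_enn2real)
  have bounds: "0 \<le> trunc u n x" "trunc u n x \<le> real n" "bounded {x. trunc u n x \<noteq> 0}" for u n x
  proof -
    show 0: "0 \<le> trunc u n x" by (simp add: trunc_def)
    have "ennreal (trunc u n x) \<le> ennreal (real n)"
      by (simp add: et indicator_def ennreal_of_nat_eq_real_of_nat)
    then show "trunc u n x \<le> real n" by (subst (asm) ennreal_le_iff) auto
    show "bounded {x. trunc u n x \<noteq> 0}"
      by (rule bounded_subset[of "{- real n..real n}"]) (auto simp: trunc_def indicator_def split: if_splits)
  qed
  have sup: "(\<integral>\<^sup>+x. u x \<partial>lborel) = (SUP n. \<integral>\<^sup>+x. trunc u n x \<partial>lborel)"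
    if [measurable]: "u \<in> borel_measurable borel" for u
  proof -
    have inc: "incseq (\<lambda>n x. ennreal (trunc u n x))"
    proof (intro incseq_SucI le_funI)
      fix n x
      show "ennreal (trunc u n x) \<le> ennreal (trunc u (Suc n) x)"
        unfolding et by (intro mult_mono min.mono) (auto simp: indicator_def)
    qed
    have "(SUP n. ennreal (trunc u n x)) = u x" for x
    proof (rule antisym)
      show "(SUP n. ennreal (trunc u n x)) \<le> u x"
        by (rule SUP_least) (auto simp: et indicator_def)
      obtain n0 :: nat where n0: "\<bar>x\<bar> \<le> real n0" using real_arch_simple by blast
      have "u x \<le> (SUP n. min (of_nat n) (u x))"
      proof (cases "u x = top")
        case True then show ?thesis by (simp add: ennreal_SUP_of_nat_eq_top)
      next
        case False
        then obtain n where "u x \<le> of_nat n" by (metis ennreal_Ex_less_of_nat less_imp_le top.not_eq_extremum)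
        then show ?thesis by (intro SUP_upper2[of n]) auto
      qed
      also have "\<dots> \<le> (SUP n. ennreal (trunc u n x))"
      proof (rule SUP_mono)
        fix n
        have "min (of_nat n) (u x) \<le> min (of_nat (max n n0)) (u x)"
          by (intro min.mono of_nat_mono) auto
        also have "\<dots> = ennreal (trunc u (max n n0) x)"
        proof -
          have "x \<in> {- real (max n n0)..real (max n n0)}" using n0 by auto
          then show ?thesis by (simp add: et)
        qed
        finally show "\<exists>m\<in>UNIV. min (of_nat n) (u x) \<le> ennreal (trunc u m x)" by blast
      qed
      finally show "u x \<le> (SUP n. ennreal (trunc u n x))" .
    qed
    then show ?thesis
      using nn_integral_monotone_convergence_SUP[OF inc, of lborel] by simp
  qed
  have "(\<integral>\<^sup>+x. trunc f n x \<partial>lborel) * (\<integral>\<^sup>+x. trunc g k x \<partial>lborel) \<le> (\<integral>\<^sup>+x. h x \<partial>lborel)\<^sup>2" for n k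
  proof (rule Prekopa_Leindler_bounded)
    fix x y
    have "ennreal (trunc f n x * trunc g k y) \<le> f x * g y"
      using bounds by (auto simp: ennreal_mult et indicator_def intro!: mult_mono)
    then show "ennreal (trunc f n x * trunc g k y) \<le> (h ((x + y) / 2))\<^sup>2"
      using h order_trans by blast
  qed (use bounds in auto)
  then have "(SUP n. \<integral>\<^sup>+x. trunc f n x \<partial>lborel) * (SUP k. \<integral>\<^sup>+x. trunc g k x \<partial>lborel) \<le> (\<integral>\<^sup>+x. h x \<partial>lborel)\<^sup>2"
    by (simp add: SUP_mult_left_ennreal SUP_mult_right_ennreal SUP_le_iff)
  then show ?thesis by (simp only: sup[OF assms(1)] sup[OF assms(2)])
qed

theorem Prekopa_Leindler_PiM:
  fixes f g h :: "('a \<Rightarrow> real) \<Rightarrow> ennreal"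
  assumes "finite I"
    and "f \<in> borel_measurable (PiM I (\<lambda>_. lborel))" "g \<in> borel_measurable (PiM I (\<lambda>_. lborel))"
      "h \<in> borel_measurable (PiM I (\<lambda>_. lborel))"
    and "\<And>x y. x \<in> extensional I \<Longrightarrow> y \<in> extensional I \<Longrightarrow> f x * g y \<le> (h (\<lambda>i\<in>I. (x i + y i) / 2))\<^sup>2"
  shows "(\<integral>\<^sup>+x. f x \<partial>PiM I (\<lambda>_. lborel)) * (\<integral>\<^sup>+x. g x \<partial>PiM I (\<lambda>_. lborel))
    \<le> (\<integral>\<^sup>+x. h x \<partial>PiM I (\<lambda>_. lborel))\<^sup>2"
  using assms
proof (induction I arbitrary: f g h rule: finite_induct)
  case empty
  interpret product_sigma_finite "\<lambda>_ :: 'a. lborel :: real measure" by standard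
  show ?case using empty(4)[of "\<lambda>_. undefined" "\<lambda>_. undefined"] by (simp add: nn_integral_empty)
next
  case (insert i I)
  interpret product_sigma_finite "\<lambda>_ :: 'a. lborel :: real measure" by standard
  interpret P: finite_product_sigma_finite "\<lambda>_ :: 'a. lborel :: real measure" I
    by standard (rule insert)
  note [measurable] = insert.prems(1-3)
  have meas: "(\<lambda>x. u (x(i := a))) \<in> borel_measurable (PiM I (\<lambda>_. lborel))"
    "(\<lambda>a. \<integral>\<^sup>+x. u (x(i := a)) \<partial>PiM I (\<lambda>_. lborel)) \<in> borel_measurable borel"
    if [measurable]: "u \<in> borel_measurable (PiM (insert i I) (\<lambda>_. lborel))" for u :: "('a \<Rightarrow> real) \<Rightarrow> ennreal" and a
    by measurable
  have "(\<integral>\<^sup>+x. f (x(i := a)) \<partial>PiM I (\<lambda>_. lborel)) * (\<integral>\<^sup>+x. g (x(i := b)) \<partial>PiM I (\<lambda>_. lborel))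
      \<le> (\<integral>\<^sup>+x. h (x(i := (a + b) / 2)) \<partial>PiM I (\<lambda>_. lborel))\<^sup>2" for a b
  proof (rule insert.IH)
    fix x y :: "'a \<Rightarrow> real" assume xy: "x \<in> extensional I" "y \<in> extensional I"
    have "(\<lambda>j\<in>insert i I. ((x(i := a)) j + (y(i := b)) j) / 2) = (\<lambda>j\<in>I. (x j + y j) / 2)(i := (a + b) / 2)"
      using insert.hyps by (auto simp: fun_eq_iff)
    moreover have "x(i := a) \<in> extensional (insert i I)" "y(i := b) \<in> extensional (insert i I)"
      using xy by (auto simp: extensional_def)
    ultimately show "f (x(i := a)) * g (y(i := b)) \<le> (h ((\<lambda>j\<in>I. (x j + y j) / 2)(i := (a + b) / 2)))\<^sup>2"
      using insert.prems(4)[of "x(i := a)" "y(i := b)"] by metis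
  qed (rule meas(1)[OF insert.prems(1)] meas(1)[OF insert.prems(2)] meas(1)[OF insert.prems(3)])+
  then have "(\<integral>\<^sup>+a. \<integral>\<^sup>+x. f (x(i := a)) \<partial>PiM I (\<lambda>_. lborel) \<partial>lborel) * (\<integral>\<^sup>+a. \<integral>\<^sup>+x. g (x(i := a)) \<partial>PiM I (\<lambda>_. lborel) \<partial>lborel)
      \<le> (\<integral>\<^sup>+a. \<integral>\<^sup>+x. h (x(i := a)) \<partial>PiM I (\<lambda>_. lborel) \<partial>lborel)\<^sup>2"
    by (intro Prekopa_Leindler_real meas insert.prems)
  then show ?case
    using insert.hyps insert.prems by (simp add: product_nn_integral_insert_rev)
qed

section \<open>Half-lines of log-concave distributions\<close>

lemma measure_nonneg_ge_quarter:
  fixes X :: "'a \<Rightarrow> real"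
  assumes "finite_measure N" and [measurable]: "X \<in> borel_measurable N"
    and mean: "(\<integral>\<^sup>+x. ennreal (- X x) \<partial>N) \<le> (\<integral>\<^sup>+x. ennreal (X x) \<partial>N)"
    and fin: "(\<integral>\<^sup>+x. ennreal (- X x) \<partial>N) < \<infinity>"
    and log_concave: "\<And>s t. measure N {x \<in> space N. s \<le> X x} * measure N {x \<in> space N. t \<le> X x}
      \<le> (measure N {x \<in> space N. (s + t) / 2 \<le> X x})\<^sup>2"
  shows "measure N (space N) \<le> 4 * measure N {x \<in> space N. 0 \<le> X x}"
proof (rule ccontr)
  interpret finite_measure N by fact
  define m where "m t = measure N {x \<in> space N. t \<le> X x}" for t
  define T where "T = measure N (space N)"
  assume "\<not> ?thesis"
  then have small: "4 * m 0 < T" by (simp add: T_def m_def)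
  have m_nonneg: "0 \<le> m t" for t by (simp add: m_def)
  have T: "T > 0" using small m_nonneg[of 0] by linarith
  have m_compl: "measure N {x \<in> space N. X x < t} = T - m t" for t
  proof -
    have "measure N (space N - {x \<in> space N. t \<le> X x}) = T - m t"
      unfolding T_def m_def by (rule finite_measure_compl) simp
    moreover have "space N - {x \<in> space N. t \<le> X x} = {x \<in> space N. X x < t}" by auto
    ultimately show ?thesis by simp
  qed
  define e where "e = enn2real (\<integral>\<^sup>+x. ennreal (- X x) \<partial>N)"
  have e: "(\<integral>\<^sup>+x. ennreal (- X x) \<partial>N) = ennreal e" using fin by (simp add: e_def)
  have "e \<noteq> 0"
  proof
    assume "e = 0"
    then have "AE x in N. \<not> X x < 0"
      using e by (simp add: nn_integral_0_iff_AE ennreal_eq_0_iff not_less)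
    then have "{x \<in> space N. X x < 0} \<in> null_sets N" by (subst (asm) AE_iff_null) auto
    then have "measure N {x \<in> space N. X x < 0} = 0" by (simp add: measure_eq_0_null_sets)
    then show False using small m_nonneg[of 0] by (simp add: m_compl)
  qed
  then have e_pos: "e > 0" by (simp add: e_def order_less_le)
  define s where "s = 2 * e / T"
  have s: "s > 0" using T e_pos by (simp add: s_def)
  have half: "T / 2 \<le> m (- s)"
  proof -
    have "ennreal s * emeasure N {x \<in> space N. X x < - s}
        = (\<integral>\<^sup>+x. ennreal s * indicator {x \<in> space N. X x < - s} x \<partial>N)"
      by (simp add: nn_integral_cmult_indicator)
    also have "\<dots> \<le> (\<integral>\<^sup>+x. ennreal (- X x) \<partial>N)"
      by (intro nn_integral_mono) (auto simp: indicator_def intro!: ennreal_leI)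
    finally have "ennreal (s * (T - m (- s))) \<le> ennreal e"
      using s e by (simp add: emeasure_eq_measure m_compl ennreal_mult')
    then have "s * (T - m (- s)) \<le> e" using e_pos by (subst (asm) ennreal_le_iff) auto
    then show ?thesis using T e_pos by (simp add: s_def field_simps)
  qed
  define q where "q = 2 * m 0 / T"
  have q: "0 \<le> q" "q < 1 / 2" using small T m_nonneg[of 0] by (auto simp: q_def field_simps)
  define a where "a k = m (real k * s - s)" for k
  have a_decr: "a (Suc k) \<le> a k" for k
    unfolding a_def m_def using s by (intro finite_measure_mono) (auto simp: algebra_simps)
  have ratio: "a (Suc k) \<le> q * a k" for k
  proof (induction k)
    case 0
    have "m 0 = q * (T / 2)" using T by (simp add: q_def)
    also have "\<dots> \<le> q * m (- s)" using half q by (intro mult_left_mono) auto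
    finally show ?case by (simp add: a_def)
  next
    case (Suc k)
    show ?case
    proof (cases "a k = 0")
      case True
      then have "a (Suc k) = 0" "a (Suc (Suc k)) = 0"
        using a_decr[of k] a_decr[of "Suc k"] m_nonneg by (auto simp: a_def order_antisym)
      then show ?thesis by simp
    next
      case False
      then have pos: "a k > 0" using m_nonneg by (simp add: a_def order_less_le)
      have "((real k * s - s) + (real (Suc (Suc k)) * s - s)) / 2 = real (Suc k) * s - s"
        by (simp add: field_simps)
      then have "a k * a (Suc (Suc k)) \<le> (a (Suc k))\<^sup>2"
        using log_concave[of "real k * s - s" "real (Suc (Suc k)) * s - s"] unfolding a_def m_def by metis
      also have "\<dots> \<le> a (Suc k) * (q * a k)"
        unfolding power2_eq_square using Suc.IH m_nonneg by (intro mult_left_mono) (auto simp: a_def)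
      finally show ?thesis using pos by (simp add: field_simps)
    qed
  qed
  have geom: "m (real k * s) \<le> m 0 * q ^ k" for k
  proof (induction k)
    case (Suc k)
    have "m (real (Suc k) * s) \<le> q * m (real k * s)"
      using ratio[of "Suc k"] by (simp add: a_def algebra_simps)
    also have "\<dots> \<le> q * (m 0 * q ^ k)" using Suc q by (intro mult_left_mono)
    finally show ?case by (simp add: ac_simps)
  qed simp
  have "ennreal e \<le> (\<integral>\<^sup>+x. ennreal (X x) \<partial>N)" using mean e by simp
  also have "\<dots> \<le> (\<integral>\<^sup>+x. (\<Sum>k. ennreal s * indicator {x \<in> space N. real k * s \<le> X x} x) \<partial>N)"
  proof (intro nn_integral_mono)
    fix x assume x: "x \<in> space N"
    show "ennreal (X x) \<le> (\<Sum>k. ennreal s * indicator {x \<in> space N. real k * s \<le> X x} x)"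
    proof (cases "X x \<le> 0")
      case False
      define n where "n = nat \<lceil>X x / s\<rceil>"
      have n: "X x \<le> real n * s" using s real_nat_ceiling_ge[of "X x / s"] by (simp add: n_def pos_divide_le_eq)
      have "real k * s \<le> X x" if "k < n" for k
      proof -
        have "real k < X x / s" using that False s unfolding n_def by linarith
        then show ?thesis using s by (simp add: field_simps)
      qed
      then have "(\<Sum>k<n. ennreal s * indicator {x \<in> space N. real k * s \<le> X x} x) = (\<Sum>k<n. ennreal s)"
        using x by (intro sum.cong) (auto simp: indicator_def)
      also have "\<dots> = ennreal (real n * s)"
        using s by (simp add: ennreal_mult ennreal_of_nat_eq_real_of_nat)
      finally have "ennreal (X x) \<le> (\<Sum>k<n. ennreal s * indicator {x \<in> space N. real k * s \<le> X x} x)"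
        using n by (simp add: ennreal_leI)
      then show ?thesis by (rule order_trans) (rule sum_le_suminf, auto)
    qed (simp add: ennreal_neg)
  qed
  also have "\<dots> = (\<Sum>k. ennreal s * emeasure N {x \<in> space N. real k * s \<le> X x})"
    by (subst nn_integral_suminf) (auto simp: nn_integral_cmult_indicator)
  also have "\<dots> = (\<Sum>k. ennreal (s * m (real k * s)))"
    using s by (simp add: m_def emeasure_eq_measure ennreal_mult')
  also have "\<dots> \<le> (\<Sum>k. ennreal (s * m 0 * q ^ k))"
    using s geom by (intro suminf_le ennreal_leI) (auto simp: mult.assoc)
  also have "\<dots> = ennreal (s * m 0 * (1 / (1 - q)))"
  proof (rule suminf_ennreal_eq)
    show "(\<lambda>k. s * m 0 * q ^ k) sums (s * m 0 * (1 / (1 - q)))"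
      using q by (intro sums_mult geometric_sums) auto
  qed (use s q m_nonneg in auto)
  finally have "e \<le> s * m 0 * (1 / (1 - q))"
    using s q m_nonneg by (subst (asm) ennreal_le_iff) auto
  also have "\<dots> = e * (q / (1 - q))" by (simp add: s_def q_def)
  also have "\<dots> < e * 1" using q e_pos by (intro mult_strict_left_mono) auto
  finally show False by simp
qed

section \<open>Average ranks and linear extensions\<close>

lemma vrank_nth:
  assumes "distinct \<sigma>" "i < length \<sigma>"
  shows "vrank \<sigma> (\<sigma> ! i) = Suc i"
proof -
  have "takeWhile (\<lambda>x. x \<noteq> \<sigma> ! i) \<sigma> = take i \<sigma>"
    using assms by (intro takeWhile_eq_take_P_nth) (auto simp: nth_eq_iff_index_eq)
  then show ?thesis using assms by (simp add: vrank_def)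
qed

lemma precedes_nth_iff:
  "distinct \<sigma> \<Longrightarrow> i < length \<sigma> \<Longrightarrow> j < length \<sigma> \<Longrightarrow> precedes \<sigma> (\<sigma> ! i) (\<sigma> ! j) \<longleftrightarrow> i < j"
  by (simp add: precedes_def vrank_nth)

lemma vrank_snoc:
  "u \<in> set \<sigma> \<Longrightarrow> vrank (\<sigma> @ [z]) u = vrank \<sigma> u"
  "z \<notin> set \<sigma> \<Longrightarrow> vrank (\<sigma> @ [z]) z = Suc (length \<sigma>)"
  by (auto simp: vrank_def takeWhile_append)

definition chain_top :: "'v list \<Rightarrow> ('v \<Rightarrow> real) \<Rightarrow> real" where
  "chain_top \<sigma> x = last (0 # map x \<sigma>)"

definition chain :: "'v list \<Rightarrow> ('v \<Rightarrow> real) \<Rightarrow> bool" where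
  "chain \<sigma> x \<longleftrightarrow> sorted_wrt (<) (0 # map x \<sigma>)"

text \<open>Under this density the successive gaps of \<open>x\<close> along \<open>\<sigma>\<close> are independent and standard
  exponential. Hence every cone has mass 1 and \<open>x u\<close> has mean \<open>vrank \<sigma> u\<close>.\<close>

definition chain_weight :: "'v list \<Rightarrow> ('v \<Rightarrow> real) \<Rightarrow> ennreal" where
  "chain_weight \<sigma> x = ennreal (exp (- chain_top \<sigma> x)) * indicator {x. chain \<sigma> x} x"

lemma chain_Nil: "chain_top [] x = 0" "chain [] x"
  by (simp_all add: chain_top_def chain_def)

lemma chain_top_snoc: "chain_top (\<sigma> @ [z]) x = x z"
  by (simp add: chain_top_def)

lemma le_chain_top:
  assumes "chain \<sigma> x" "y \<in> set (0 # map x \<sigma>)"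
  shows "y \<le> chain_top \<sigma> x"
proof -
  have "sorted (0 # map x \<sigma>)"
    using assms(1) unfolding chain_def by (rule sorted_wrt_mono_rel[rotated]) simp
  moreover obtain i where "i < length (0 # map x \<sigma>)" "y = (0 # map x \<sigma>) ! i"
    using assms(2) by (metis in_set_conv_nth)
  ultimately show ?thesis
    unfolding chain_top_def by (subst last_conv_nth) (auto intro!: sorted_nth_mono)
qed

lemma chain_snoc: "chain (\<sigma> @ [z]) x \<longleftrightarrow> chain \<sigma> x \<and> chain_top \<sigma> x < x z"
proof -
  have "chain (\<sigma> @ [z]) x \<longleftrightarrow> chain \<sigma> x \<and> (\<forall>y\<in>set (0 # map x \<sigma>). y < x z)"
    by (auto simp: chain_def sorted_wrt_append)
  moreover have "chain_top \<sigma> x \<in> set (0 # map x \<sigma>)"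
    unfolding chain_top_def by (rule last_in_set) simp
  ultimately show ?thesis using le_chain_top[of \<sigma> x] by (meson order_le_less_trans)
qed

lemma chain_upd:
  assumes "z \<notin> set \<sigma>"
  shows "chain_top \<sigma> (x(z := y)) = chain_top \<sigma> x" "chain \<sigma> (x(z := y)) = chain \<sigma> x"
proof -
  have "map (x(z := y)) \<sigma> = map x \<sigma>" using assms by auto
  then show "chain_top \<sigma> (x(z := y)) = chain_top \<sigma> x" "chain \<sigma> (x(z := y)) = chain \<sigma> x"
    by (simp_all only: chain_top_def chain_def)
qed

lemma chain_top_nonneg: "chain \<sigma> x \<Longrightarrow> 0 \<le> chain_top \<sigma> x"
  using le_chain_top[of \<sigma> x 0] by simp

lemma measurable_chain:
  assumes "set \<sigma> \<subseteq> I"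
  shows "chain_top \<sigma> \<in> borel_measurable (PiM I (\<lambda>_. lborel))"
    and "Measurable.pred (PiM I (\<lambda>_. lborel)) (chain \<sigma>)"
    and "chain_weight \<sigma> \<in> borel_measurable (PiM I (\<lambda>_. lborel))"
proof -
  have "chain_top \<sigma> \<in> borel_measurable (PiM I (\<lambda>_. lborel)) \<and> Measurable.pred (PiM I (\<lambda>_. lborel)) (chain \<sigma>)"
    using assms
  proof (induction \<sigma> rule: rev_induct)
    case Nil
    have "chain_top [] = (\<lambda>_ :: 'a \<Rightarrow> real. 0)" "chain [] = (\<lambda>_ :: 'a \<Rightarrow> real. True)" by (auto simp: chain_Nil)
    then show ?case by simp
  next
    case (snoc z \<sigma>)
    then have [measurable]: "chain_top \<sigma> \<in> borel_measurable (PiM I (\<lambda>_. lborel))"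
      "Measurable.pred (PiM I (\<lambda>_. lborel)) (chain \<sigma>)" and z[measurable]: "z \<in> I" by auto
    show ?case unfolding chain_top_snoc[abs_def] chain_snoc[abs_def] by measurable
  qed
  then show 1[measurable]: "chain_top \<sigma> \<in> borel_measurable (PiM I (\<lambda>_. lborel))"
    "Measurable.pred (PiM I (\<lambda>_. lborel)) (chain \<sigma>)" by auto
  show "chain_weight \<sigma> \<in> borel_measurable (PiM I (\<lambda>_. lborel))"
    unfolding chain_weight_def[abs_def] by measurable
qed

lemma nn_integral_exp_tail:
  "(\<integral>\<^sup>+y. ennreal (exp (- y)) * indicator {L<..} y \<partial>lborel) = ennreal (exp (- L))"
proof -
  have "(\<integral>\<^sup>+y. ennreal (exp (- y)) * indicator {L<..} y \<partial>lborel)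
      = (\<integral>\<^sup>+y. ennreal (exp (- y)) * indicator {L..} y \<partial>lborel)"
    by (intro nn_integral_cong_AE eventually_mono[OF AE_lborel_singleton[of L]]) (auto simp: indicator_def)
  also have "\<dots> = ennreal (0 - (- exp (- L)))"
    by (rule nn_integral_FTC_atLeast) (auto intro!: derivative_eq_intros, real_asymp)
  finally show ?thesis by simp
qed

lemma nn_integral_mult_exp_tail:
  assumes "0 \<le> L"
  shows "(\<integral>\<^sup>+y. ennreal (y * exp (- y)) * indicator {L<..} y \<partial>lborel) = ennreal ((L + 1) * exp (- L))"
proof -
  have "(\<integral>\<^sup>+y. ennreal (y * exp (- y)) * indicator {L<..} y \<partial>lborel)
      = (\<integral>\<^sup>+y. ennreal (y * exp (- y)) * indicator {L..} y \<partial>lborel)"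
    by (intro nn_integral_cong_AE eventually_mono[OF AE_lborel_singleton[of L]]) (auto simp: indicator_def)
  also have "\<dots> = ennreal (0 - (- (L + 1) * exp (- L)))"
    using assms
    by (intro nn_integral_FTC_atLeast) (auto intro!: derivative_eq_intros simp: algebra_simps, real_asymp)
  finally show ?thesis by (simp add: algebra_simps)
qed

lemma nn_integral_chain_snoc:
  fixes g :: "('v \<Rightarrow> real) \<Rightarrow> ennreal"
  assumes z: "z \<notin> set \<sigma>"
    and [measurable]: "g \<in> borel_measurable (PiM (insert z (set \<sigma>)) (\<lambda>_. lborel))"
  shows "(\<integral>\<^sup>+x. g x * chain_weight (\<sigma> @ [z]) x \<partial>PiM (set (\<sigma> @ [z])) (\<lambda>_. lborel))
    = (\<integral>\<^sup>+x. (\<integral>\<^sup>+y. g (x(z := y)) * (ennreal (exp (- y)) * indicator {chain_top \<sigma> x<..} y) \<partial>lborel)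
        * indicator {x. chain \<sigma> x} x \<partial>PiM (set \<sigma>) (\<lambda>_. lborel))"
proof -
  interpret product_sigma_finite "\<lambda>_ :: 'v. lborel :: real measure" by standard
  note [measurable] = measurable_chain
  have ins: "set (\<sigma> @ [z]) = insert z (set \<sigma>)" by simp
  have "(\<integral>\<^sup>+x. g x * chain_weight (\<sigma> @ [z]) x \<partial>PiM (set (\<sigma> @ [z])) (\<lambda>_. lborel))
    = (\<integral>\<^sup>+x. \<integral>\<^sup>+y. g (x(z := y)) * chain_weight (\<sigma> @ [z]) (x(z := y)) \<partial>lborel \<partial>PiM (set \<sigma>) (\<lambda>_. lborel))"
    unfolding ins using z by (intro product_nn_integral_insert) auto
  also have "\<dots> = (\<integral>\<^sup>+x. (\<integral>\<^sup>+y. g (x(z := y)) * (ennreal (exp (- y)) * indicator {chain_top \<sigma> x<..} y)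
        * indicator {x. chain \<sigma> x} x \<partial>lborel) \<partial>PiM (set \<sigma>) (\<lambda>_. lborel))"
    using z by (intro nn_integral_cong)
      (auto simp: chain_weight_def chain_top_snoc chain_snoc chain_upd indicator_def)
  also have "\<dots> = (\<integral>\<^sup>+x. (\<integral>\<^sup>+y. g (x(z := y)) * (ennreal (exp (- y)) * indicator {chain_top \<sigma> x<..} y) \<partial>lborel)
        * indicator {x. chain \<sigma> x} x \<partial>PiM (set \<sigma>) (\<lambda>_. lborel))"
    by (intro nn_integral_cong nn_integral_multc) measurable
  finally show ?thesis .
qed

lemma nn_integral_chain_weight:
  assumes "distinct \<sigma>"
  shows "(\<integral>\<^sup>+x. chain_weight \<sigma> x \<partial>PiM (set \<sigma>) (\<lambda>_. lborel)) = 1"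
  using assms
proof (induction \<sigma> rule: rev_induct)
  case Nil
  interpret product_sigma_finite "\<lambda>_ :: 'a. lborel :: real measure" by standard
  show ?case by (simp add: chain_weight_def chain_Nil space_PiM_empty emeasure_PiM_empty)
next
  case (snoc z \<sigma>)
  then show ?case
    using nn_integral_chain_snoc[of z \<sigma> "\<lambda>_. 1"] by (simp add: nn_integral_exp_tail chain_weight_def)
qed

lemma nn_integral_mult_last_chain:
  assumes "z \<notin> set \<sigma>"
  shows "(\<integral>\<^sup>+x. ennreal (x z) * chain_weight (\<sigma> @ [z]) x \<partial>PiM (set (\<sigma> @ [z])) (\<lambda>_. lborel))
    = (\<integral>\<^sup>+x. ennreal (chain_top \<sigma> x) * chain_weight \<sigma> x \<partial>PiM (set \<sigma>) (\<lambda>_. lborel))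
      + (\<integral>\<^sup>+x. chain_weight \<sigma> x \<partial>PiM (set \<sigma>) (\<lambda>_. lborel))"
proof -
  note [measurable] = measurable_chain
  have "(\<integral>\<^sup>+y. ennreal y * (ennreal (exp (- y)) * indicator {chain_top \<sigma> x<..} y) \<partial>lborel)
      = ennreal (chain_top \<sigma> x) * ennreal (exp (- chain_top \<sigma> x)) + ennreal (exp (- chain_top \<sigma> x))"
    if "chain \<sigma> x" for x
  proof -
    have "(\<integral>\<^sup>+y. ennreal y * (ennreal (exp (- y)) * indicator {chain_top \<sigma> x<..} y) \<partial>lborel)
        = (\<integral>\<^sup>+y. ennreal (y * exp (- y)) * indicator {chain_top \<sigma> x<..} y \<partial>lborel)"
      using chain_top_nonneg[OF that]
      by (intro nn_integral_cong) (auto simp: indicator_def ennreal_mult)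
    then show ?thesis
      using chain_top_nonneg[OF that] nn_integral_mult_exp_tail
      by (simp add: distrib_right ennreal_mult)
  qed
  then have "(\<integral>\<^sup>+x. ennreal (x z) * chain_weight (\<sigma> @ [z]) x \<partial>PiM (set (\<sigma> @ [z])) (\<lambda>_. lborel))
    = (\<integral>\<^sup>+x. ennreal (chain_top \<sigma> x) * chain_weight \<sigma> x + chain_weight \<sigma> x \<partial>PiM (set \<sigma>) (\<lambda>_. lborel))"
    using assms
    by (subst nn_integral_chain_snoc) (auto simp: chain_weight_def indicator_def intro!: nn_integral_cong)
  also have "\<dots> = (\<integral>\<^sup>+x. ennreal (chain_top \<sigma> x) * chain_weight \<sigma> x \<partial>PiM (set \<sigma>) (\<lambda>_. lborel))
      + (\<integral>\<^sup>+x. chain_weight \<sigma> x \<partial>PiM (set \<sigma>) (\<lambda>_. lborel))"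
    by (intro nn_integral_add) measurable
  finally show ?thesis .
qed

lemma nn_integral_chain_top:
  assumes "distinct \<sigma>"
  shows "(\<integral>\<^sup>+x. ennreal (chain_top \<sigma> x) * chain_weight \<sigma> x \<partial>PiM (set \<sigma>) (\<lambda>_. lborel)) = of_nat (length \<sigma>)"
  using assms
proof (induction \<sigma> rule: rev_induct)
  case Nil
  show ?case by (simp add: chain_Nil)
next
  case (snoc z \<sigma>)
  then show ?case
    by (simp add: chain_top_snoc nn_integral_mult_last_chain[simplified] nn_integral_chain_weight add.commute)
qed

lemma nn_integral_chain_component:
  assumes "distinct \<sigma>" "u \<in> set \<sigma>"
  shows "(\<integral>\<^sup>+x. ennreal (x u) * chain_weight \<sigma> x \<partial>PiM (set \<sigma>) (\<lambda>_. lborel)) = of_nat (vrank \<sigma> u)"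
  using assms
proof (induction \<sigma> rule: rev_induct)
  case (snoc z \<sigma>)
  show ?case
  proof (cases "u = z")
    case True
    then show ?thesis
      using snoc.prems nn_integral_chain_top[of "\<sigma> @ [z]"] by (simp add: chain_top_snoc vrank_snoc)
  next
    case False
    then have u: "u \<in> set \<sigma>" and z: "z \<notin> set \<sigma>" using snoc.prems by auto
    note [measurable] = measurable_chain
    have "(\<integral>\<^sup>+x. ennreal (x u) * chain_weight (\<sigma> @ [z]) x \<partial>PiM (set (\<sigma> @ [z])) (\<lambda>_. lborel))
      = (\<integral>\<^sup>+x. ennreal (x u) * chain_weight \<sigma> x \<partial>PiM (set \<sigma>) (\<lambda>_. lborel))"
      using z u False
      by (subst nn_integral_chain_snoc)
        (auto simp: nn_integral_cmult nn_integral_exp_tail chain_weight_def mult.assoc)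
    then show ?thesis using snoc u z by (simp add: vrank_snoc)
  qed
qed simp

lemma chain_less_iff_precedes:
  assumes "chain \<sigma> x" "distinct \<sigma>" "a \<in> set \<sigma>" "b \<in> set \<sigma>"
  shows "x a < x b \<longleftrightarrow> precedes \<sigma> a b"
proof -
  obtain i j where ij: "i < length \<sigma>" "a = \<sigma> ! i" "j < length \<sigma>" "b = \<sigma> ! j"
    using assms by (metis in_set_conv_nth)
  have mono: "x (\<sigma> ! k) < x (\<sigma> ! l)" if "k < l" "l < length \<sigma>" for k l
    using assms(1) that sorted_wrt_nth_less[of "(<)" "map x \<sigma>" k l] by (auto simp: chain_def)
  have "x (\<sigma> ! i) < x (\<sigma> ! j) \<longleftrightarrow> i < j"
    using mono[of i j] mono[of j i] ij by (metis less_asym linorder_neqE_nat order_less_irrefl)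
  then show ?thesis using ij assms(2) by (simp add: precedes_nth_iff)
qed

lemma precedes_total:
  assumes "distinct \<sigma>" "a \<in> set \<sigma>" "b \<in> set \<sigma>" "a \<noteq> b"
  shows "precedes \<sigma> a b \<or> precedes \<sigma> b a"
proof -
  obtain i j where "i < length \<sigma>" "a = \<sigma> ! i" "j < length \<sigma>" "b = \<sigma> ! j"
    using assms by (metis in_set_conv_nth)
  then show ?thesis using assms by (cases i j rule: linorder_cases) (auto simp: precedes_nth_iff)
qed

lemma chain_unique:
  assumes "chain \<sigma> x" "chain \<tau> x" "set \<sigma> = set \<tau>" "inj_on x (set \<sigma>)"
  shows "\<sigma> = \<tau>"
proof -
  have "map x \<sigma> = map x \<tau>"
    using assms(1-3) by (intro strict_sorted_equal) (auto simp: chain_def)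
  then show ?thesis using assms(3,4) by (simp add: inj_on_map_eq_map)
qed

lemma chain_exists:
  assumes "finite V" "inj_on x V" "\<And>i. i \<in> V \<Longrightarrow> 0 < x i"
  obtains \<sigma> where "\<sigma> \<in> permutations_of_set V" "chain \<sigma> x"
proof -
  define l where "l = sorted_list_of_set (x ` V)"
  define \<sigma> where "\<sigma> = map (inv_into V x) l"
  have l: "set l = x ` V" "distinct l" "sorted_wrt (<) l"
    using assms(1) by (auto simp: l_def)
  have x\<sigma>: "map x \<sigma> = l" using l(1) by (auto simp: \<sigma>_def f_inv_into_f intro!: map_idI)
  have "set \<sigma> = V" using l(1) assms(2) by (auto simp: \<sigma>_def inv_into_into)
  moreover have "distinct \<sigma>" using x\<sigma> l(2) by (metis distinct_map)
  moreover have "chain \<sigma> x" using x\<sigma> l assms(3) by (auto simp: chain_def)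
  ultimately show ?thesis using that by (auto intro: permutations_of_setI)
qed

definition poset_weight :: "'v set \<Rightarrow> ('v \<times> 'v) set \<Rightarrow> ('v \<Rightarrow> real) \<Rightarrow> ennreal" where
  "poset_weight V D x = ennreal (exp (- Max (insert 0 (x ` V)))) *
     indicator {x. (\<forall>i\<in>V. 0 < x i) \<and> (\<forall>(a, b)\<in>D. x a < x b)} x"

lemma finite_compatible: "finite V \<Longrightarrow> finite (compatible V D)"
  by (simp add: compatible_def)

lemma poset_weight_eq_sum_chain_weight:
  assumes V: "finite V" and D: "D \<subseteq> V \<times> V" and inj: "inj_on x V"
  shows "poset_weight V D x = (\<Sum>\<sigma>\<in>compatible V D. chain_weight \<sigma> x)"
proof -
  define P where "P \<longleftrightarrow> (\<forall>i\<in>V. 0 < x i) \<and> (\<forall>(a, b)\<in>D. x a < x b)"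
  have compat: "\<sigma> \<in> compatible V D \<longleftrightarrow> P" if "\<sigma> \<in> permutations_of_set V" "chain \<sigma> x" for \<sigma>
  proof -
    have \<sigma>: "set \<sigma> = V" "distinct \<sigma>" using that(1) by (auto dest: permutations_of_setD)
    have "0 < x i" if "i \<in> V" for i
      using \<open>chain \<sigma> x\<close> that \<sigma> by (auto simp: chain_def)
    moreover have "(x a < x b) = precedes \<sigma> a b" if "(a, b) \<in> D" for a b
      using that D \<sigma> \<open>chain \<sigma> x\<close> by (intro chain_less_iff_precedes) auto
    ultimately show ?thesis using that(1) by (auto simp: compatible_def P_def)
  qed
  show ?thesis
  proof (cases P)
    case True
    then obtain \<sigma> where \<sigma>: "\<sigma> \<in> permutations_of_set V" "chain \<sigma> x"
      using chain_exists[OF V inj] by (auto simp: P_def)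
    then have set: "set \<sigma> = V" by (auto dest: permutations_of_setD)
    have "(\<Sum>\<tau>\<in>compatible V D. chain_weight \<tau> x) = (\<Sum>\<tau>\<in>compatible V D. if \<tau> = \<sigma> then chain_weight \<sigma> x else 0)"
    proof (intro sum.cong refl)
      fix \<tau> assume "\<tau> \<in> compatible V D"
      then have "set \<tau> = V" by (auto simp: compatible_def dest: permutations_of_setD)
      then show "chain_weight \<tau> x = (if \<tau> = \<sigma> then chain_weight \<sigma> x else 0)"
        using chain_unique[OF \<sigma>(2), of \<tau>] set inj by (auto simp: chain_weight_def indicator_def)
    qed
    also have "\<dots> = chain_weight \<sigma> x"
      using compat[OF \<sigma>] True by (simp add: finite_compatible V)
    also have "chain_top \<sigma> x = Max (insert 0 (x ` V))"
    proof (rule Max_eqI[symmetric])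
      show "chain_top \<sigma> x \<in> insert 0 (x ` V)"
        using last_in_set[of "0 # map x \<sigma>"] set by (simp add: chain_top_def)
    qed (use V set le_chain_top[OF \<sigma>(2)] in auto)
    then have "chain_weight \<sigma> x = poset_weight V D x"
      using \<sigma>(2) True by (auto simp: chain_weight_def poset_weight_def P_def)
    finally show ?thesis by simp
  next
    case False
    then have "chain_weight \<sigma> x = 0" if "\<sigma> \<in> compatible V D" for \<sigma>
      using compat[of \<sigma>] that by (auto simp: chain_weight_def indicator_def compatible_def)
    moreover have "poset_weight V D x = 0" using False by (auto simp: poset_weight_def P_def indicator_def)
    ultimately show ?thesis by simp
  qed
qed

lemma measurable_poset_weight:
  assumes "finite V" "D \<subseteq> V \<times> V"
  shows "poset_weight V D \<in> borel_measurable (PiM V (\<lambda>_. lborel))"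
proof -
  have [measurable]: "(\<lambda>x. Max (insert 0 (x ` V))) \<in> borel_measurable (PiM V (\<lambda>_. lborel :: real measure))"
  proof -
    have "(\<lambda>x. Max ((\<lambda>i. case i of None \<Rightarrow> 0 | Some j \<Rightarrow> x j) ` (insert None (Some ` V))))
        \<in> borel_measurable (PiM V (\<lambda>_. lborel :: real measure))"
      using assms(1) by (intro borel_measurable_Max) auto
    then show ?thesis by (simp add: image_image)
  qed
  have "finite D" using assms finite_subset by blast
  then have [measurable]: "Measurable.pred (PiM V (\<lambda>_. lborel :: real measure)) (\<lambda>x. \<forall>p\<in>D. x (fst p) < x (snd p))"
  proof (rule pred_intros_finite)
    fix p assume "p \<in> D"
    then have [measurable]: "fst p \<in> V" "snd p \<in> V" using assms by auto
    show "Measurable.pred (PiM V (\<lambda>_. lborel :: real measure)) (\<lambda>x. x (fst p) < x (snd p))" by measurable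
  qed
  have [measurable]: "Measurable.pred (PiM V (\<lambda>_. lborel :: real measure)) (\<lambda>x. \<forall>i\<in>V. 0 < x i)"
    using assms(1) by (rule pred_intros_finite) measurable
  show ?thesis unfolding poset_weight_def[abs_def] case_prod_beta by measurable
qed

lemma AE_PiM_lborel_inj_on:
  assumes "finite V"
  shows "AE x in PiM V (\<lambda>_. lborel :: real measure). inj_on x V"
proof -
  interpret product_sigma_finite "\<lambda>_ :: 'a. lborel :: real measure" by standard
  have ne: "AE x in PiM V (\<lambda>_. lborel :: real measure). x a \<noteq> x b" if ab: "a \<in> V" "b \<in> V" "a \<noteq> b" for a b
  proof -
    have V: "V = insert a (V - {a})" using ab by auto
    define Q where "Q = PiM V (\<lambda>_. lborel :: real measure)"
    have [measurable]: "(\<lambda>x. x a) \<in> borel_measurable Q" "(\<lambda>x. x b) \<in> borel_measurable Q"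
      using ab unfolding Q_def by measurable
    have "(\<lambda>x. indicator {x \<in> space Q. x a = x b} x :: ennreal) \<in> borel_measurable Q"
      by (intro borel_measurable_indicator borel_measurable_eq) measurable
    then have meas: "(\<lambda>x. indicator {x. x a = x b} x :: ennreal) \<in> borel_measurable (PiM V (\<lambda>_. lborel :: real measure))"
      unfolding Q_def by (rule measurable_cong[THEN iffD1, rotated]) (simp add: indicator_def)
    have "(\<integral>\<^sup>+x. indicator {x. x a = x b} x \<partial>PiM (insert a (V - {a})) (\<lambda>_. lborel :: real measure))
        = (\<integral>\<^sup>+x. \<integral>\<^sup>+y. indicator {x. x a = x b} (x(a := y)) \<partial>lborel \<partial>PiM (V - {a}) (\<lambda>_. lborel :: real measure))"
      using assms meas V by (intro product_nn_integral_insert) auto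
    also have "\<dots> = (\<integral>\<^sup>+x. \<integral>\<^sup>+y. indicator {x b} y \<partial>lborel \<partial>PiM (V - {a}) (\<lambda>_. lborel :: real measure))"
      using ab by (intro nn_integral_cong) (auto simp: indicator_def)
    also have "\<dots> = 0" by simp
    finally have "(\<integral>\<^sup>+x. indicator {x. x a = x b} x \<partial>PiM V (\<lambda>_. lborel :: real measure)) = 0"
      using V by simp
    then have "AE x in PiM V (\<lambda>_. lborel :: real measure). indicator {x. x a = x b} x = (0 :: ennreal)"
      using meas by (simp add: nn_integral_0_iff_AE)
    then show ?thesis by eventually_elim (auto simp: indicator_def split: if_splits)
  qed
  have "AE x in PiM V (\<lambda>_. lborel :: real measure). \<forall>a\<in>V. \<forall>b\<in>V. a \<noteq> b \<longrightarrow> x a \<noteq> x b"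
    using assms ne by (intro AE_finite_allI) auto
  then show ?thesis by eventually_elim (auto simp: inj_on_def)
qed

lemma nn_integral_poset_weight:
  assumes V: "finite V" and D: "D \<subseteq> V \<times> V"
    and [measurable]: "g \<in> borel_measurable (PiM V (\<lambda>_. lborel))"
  shows "(\<integral>\<^sup>+x. poset_weight V D x * g x \<partial>PiM V (\<lambda>_. lborel))
    = (\<Sum>\<sigma>\<in>compatible V D. \<integral>\<^sup>+x. g x * chain_weight \<sigma> x \<partial>PiM V (\<lambda>_. lborel))"
proof -
  have "(\<integral>\<^sup>+x. poset_weight V D x * g x \<partial>PiM V (\<lambda>_. lborel))
      = (\<integral>\<^sup>+x. (\<Sum>\<sigma>\<in>compatible V D. g x * chain_weight \<sigma> x) \<partial>PiM V (\<lambda>_. lborel))"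
    by (intro nn_integral_cong_AE eventually_mono[OF AE_PiM_lborel_inj_on[OF V]])
      (simp add: poset_weight_eq_sum_chain_weight V D sum_distrib_left mult.commute)
  also have "\<dots> = (\<Sum>\<sigma>\<in>compatible V D. \<integral>\<^sup>+x. g x * chain_weight \<sigma> x \<partial>PiM V (\<lambda>_. lborel))"
    using measurable_chain(3)
    by (intro nn_integral_sum borel_measurable_times_ennreal)
      (auto simp: compatible_def dest: permutations_of_setD)
  finally show ?thesis .
qed

lemma poset_weight_log_concave:
  assumes V: "finite V" and D: "D \<subseteq> V \<times> V"
  shows "poset_weight V D x * poset_weight V D y \<le> (poset_weight V D (\<lambda>i\<in>V. (x i + y i) / 2))\<^sup>2"
proof -
  define z where "z = (\<lambda>i\<in>V. (x i + y i) / 2)"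
  define M where "M w = Max (insert 0 (w ` V))" for w :: "'a \<Rightarrow> real"
  define P where "P w \<longleftrightarrow> (\<forall>i\<in>V. 0 < w i) \<and> (\<forall>(a, b)\<in>D. w a < w b)" for w :: "'a \<Rightarrow> real"
  have pw: "poset_weight V D w = ennreal (exp (- M w)) * indicator {w. P w} w" for w
    by (simp add: poset_weight_def M_def P_def)
  show ?thesis
  proof (cases "P x \<and> P y")
    case True
    have "0 < z i" if "i \<in> V" for i
      using True that by (auto simp: P_def z_def intro!: add_pos_pos)
    moreover have "z a < z b" if "(a, b) \<in> D" for a b
    proof -
      have "a \<in> V" "b \<in> V" using that D by auto
      moreover have "x a < x b" "y a < y b" using True that by (auto simp: P_def)
      ultimately show ?thesis by (simp add: z_def)
    qed
    ultimately have "P z" by (auto simp: P_def)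
    have "M z \<le> (M x + M y) / 2"
      unfolding M_def[of z]
    proof (rule Max.boundedI)
      fix t assume "t \<in> insert 0 (z ` V)"
      moreover have "0 \<le> M w" "i \<in> V \<Longrightarrow> w i \<le> M w" for w i
        using V by (auto simp: M_def)
      ultimately show "t \<le> (M x + M y) / 2"
        by (auto simp: z_def intro!: add_mono)
    qed (use V in auto)
    then have "exp (- M x) * exp (- M y) \<le> (exp (- M z))\<^sup>2"
      by (simp add: power2_eq_square exp_add[symmetric])
    then have "ennreal (exp (- M x) * exp (- M y)) \<le> ennreal ((exp (- M z))\<^sup>2)" by (rule ennreal_leI)
    then show ?thesis using True \<open>P z\<close> by (simp add: pw z_def[symmetric] ennreal_mult ennreal_power)
  qed (auto simp: pw)
qed

theorem card_compatible_le_4_card_precedes: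
  assumes V: "finite V" and D: "D \<subseteq> V \<times> V" and uv: "u \<in> V" "v \<in> V" "u \<noteq> v"
    and avg: "avg_rank V D u \<le> avg_rank V D v"
  shows "card (compatible V D) \<le> 4 * card {\<sigma> \<in> compatible V D. precedes \<sigma> u v}"
proof (cases "compatible V D = {}")
  case False
  define M where "M = PiM V (\<lambda>_. lborel :: real measure)"
  define N where "N = density M (poset_weight V D)"
  define X where "X x = x v - x u" for x :: "'a \<Rightarrow> real"
  have fin: "finite (compatible V D)" using V by (rule finite_compatible)
  have [measurable]: "u \<in> V" "v \<in> V" by fact+
  have w[measurable]: "poset_weight V D \<in> borel_measurable M"
    unfolding M_def using V D by (rule measurable_poset_weight)
  have comp[measurable]: "(\<lambda>x. x i) \<in> borel_measurable M" if "i \<in> V" for i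
    using that unfolding M_def by measurable
  have X[measurable]: "X \<in> borel_measurable M" using uv unfolding X_def[abs_def] by measurable
  have space: "space N = space M" by (simp add: N_def)
  have perm: "set \<sigma> = V" "distinct \<sigma>" if "\<sigma> \<in> compatible V D" for \<sigma>
    using that by (auto simp: compatible_def dest: permutations_of_setD)
  have mass: "(\<integral>\<^sup>+x. chain_weight \<sigma> x \<partial>M) = 1" if "\<sigma> \<in> compatible V D" for \<sigma>
    using nn_integral_chain_weight[of \<sigma>] perm[OF that] by (simp add: M_def)
  have intN: "(\<integral>\<^sup>+x. g x \<partial>N) = (\<Sum>\<sigma>\<in>compatible V D. \<integral>\<^sup>+x. g x * chain_weight \<sigma> x \<partial>M)"
    if [measurable]: "g \<in> borel_measurable M" for g
    using nn_integral_density[OF w that] nn_integral_poset_weight[OF V D, of g, folded M_def] that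
    by (simp add: N_def)
  have emN: "emeasure N A = (\<Sum>\<sigma>\<in>compatible V D. \<integral>\<^sup>+x. indicator A x * chain_weight \<sigma> x \<partial>M)"
    if "A \<in> sets M" for A
    using intN[of "indicator A"] that by (simp add: N_def)
  have "emeasure N (space M) = (\<Sum>\<sigma>\<in>compatible V D. \<integral>\<^sup>+x. chain_weight \<sigma> x \<partial>M)"
    by (subst emN) (auto intro!: sum.cong nn_integral_cong)
  also have "\<dots> = of_nat (card (compatible V D))"
    by (simp add: mass)
  finally have total: "emeasure N (space M) = of_nat (card (compatible V D))" .
  interpret N: finite_measure N
    by (rule finite_measureI) (simp add: space total)
  have "emeasure N {x \<in> space M. 0 \<le> X x}
      = (\<Sum>\<sigma>\<in>compatible V D. if precedes \<sigma> u v then 1 else 0)"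
  proof (subst emN, simp, intro sum.cong refl)
    fix \<sigma> assume \<sigma>: "\<sigma> \<in> compatible V D"
    have "indicator {x \<in> space M. 0 \<le> X x} x * chain_weight \<sigma> x
        = (if precedes \<sigma> u v then chain_weight \<sigma> x else 0)" if "x \<in> space M" for x
    proof (cases "chain \<sigma> x")
      case True
      have *: "(x u < x v) = precedes \<sigma> u v" "(x v < x u) = precedes \<sigma> v u"
        using chain_less_iff_precedes[OF True] perm[OF \<sigma>] uv by auto
      have "precedes \<sigma> u v \<or> precedes \<sigma> v u"
        using precedes_total[of \<sigma> u v] perm[OF \<sigma>] uv by simp
      then have "0 \<le> X x \<longleftrightarrow> precedes \<sigma> u v" using * unfolding X_def by linarith
      then show ?thesis using that by (simp add: indicator_def)
    qed (simp add: chain_weight_def)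
    then have "(\<integral>\<^sup>+x. indicator {x \<in> space M. 0 \<le> X x} x * chain_weight \<sigma> x \<partial>M)
        = (\<integral>\<^sup>+x. (if precedes \<sigma> u v then chain_weight \<sigma> x else 0) \<partial>M)"
      by (intro nn_integral_cong)
    also have "\<dots> = (if precedes \<sigma> u v then 1 else 0)"
      by (simp add: mass[OF \<sigma>])
    finally show "(\<integral>\<^sup>+x. indicator {x \<in> space M. 0 \<le> X x} x * chain_weight \<sigma> x \<partial>M)
      = (if precedes \<sigma> u v then 1 else 0)" .
  qed
  also have "\<dots> = of_nat (card {\<sigma> \<in> compatible V D. precedes \<sigma> u v})"
    using fin by (simp add: sum.If_cases Int_def)
  finally have before: "emeasure N {x \<in> space M. 0 \<le> X x} = of_nat (card {\<sigma> \<in> compatible V D. precedes \<sigma> u v})" .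
  define S where "S i = (\<Sum>\<sigma>\<in>compatible V D. real (vrank \<sigma> i))" for i
  have mean: "(\<integral>\<^sup>+x. ennreal (x i) \<partial>N) = ennreal (S i)" if "i \<in> V" for i
  proof -
    have "(\<integral>\<^sup>+x. ennreal (x i) \<partial>N) = (\<Sum>\<sigma>\<in>compatible V D. of_nat (vrank \<sigma> i))"
    proof (subst intN)
      show "(\<lambda>x. ennreal (x i)) \<in> borel_measurable M" using comp[OF that] by measurable
      show "(\<Sum>\<sigma>\<in>compatible V D. \<integral>\<^sup>+x. ennreal (x i) * chain_weight \<sigma> x \<partial>M)
          = (\<Sum>\<sigma>\<in>compatible V D. of_nat (vrank \<sigma> i))"
      proof (intro sum.cong refl)
        fix \<sigma> assume "\<sigma> \<in> compatible V D"
        then show "(\<integral>\<^sup>+x. ennreal (x i) * chain_weight \<sigma> x \<partial>M) = of_nat (vrank \<sigma> i)"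
          using nn_integral_chain_component[of \<sigma> i] perm[of \<sigma>] that by (simp add: M_def)
      qed
    qed
    then show ?thesis by (simp add: S_def ennreal_of_nat_eq_real_of_nat)
  qed
  have S_le: "S u \<le> S v" "0 \<le> S u" "0 \<le> S v"
    using avg False fin by (auto simp: avg_rank_def S_def divide_le_cancel sum_nonneg card_gt_0_iff)
  have pos: "AE x in N. 0 < x u \<and> 0 < x v"
    unfolding N_def using uv
    by (subst AE_density) (auto simp: poset_weight_def indicator_def split: if_splits intro!: AE_I2)
  have "(\<integral>\<^sup>+x. ennreal (- X x) \<partial>N) \<le> (\<integral>\<^sup>+x. ennreal (x u) \<partial>N)"
    by (intro nn_integral_mono_AE eventually_mono[OF pos]) (auto simp: X_def intro!: ennreal_leI)
  then have fin_neg: "(\<integral>\<^sup>+x. ennreal (- X x) \<partial>N) < \<infinity>" 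
    using mean[OF uv(1)] ennreal_less_top[of "S u"] by (simp add: order_le_less_trans)
  have [measurable_cong]: "sets N = sets M" by (simp add: N_def)
  have "(\<integral>\<^sup>+x. ennreal (- X x) \<partial>N) + ennreal (S v) = (\<integral>\<^sup>+x. ennreal (- X x) + ennreal (x v) \<partial>N)"
    using uv by (subst nn_integral_add) (auto simp: mean)
  also have "\<dots> = (\<integral>\<^sup>+x. ennreal (X x) + ennreal (x u) \<partial>N)"
  proof (intro nn_integral_cong_AE eventually_mono[OF pos])
    fix x :: "'a \<Rightarrow> real" assume "0 < x u \<and> 0 < x v"
    then show "ennreal (- X x) + ennreal (x v) = ennreal (X x) + ennreal (x u)"
      by (cases "x u \<le> x v") (auto simp: X_def ennreal_neg simp flip: ennreal_plus)
  qed
  also have "\<dots> = (\<integral>\<^sup>+x. ennreal (X x) \<partial>N) + ennreal (S u)"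
    using uv by (subst nn_integral_add) (auto simp: mean)
  also have "\<dots> \<le> (\<integral>\<^sup>+x. ennreal (X x) \<partial>N) + ennreal (S v)"
    using S_le by (intro add_left_mono ennreal_leI)
  finally have mean_X: "(\<integral>\<^sup>+x. ennreal (- X x) \<partial>N) \<le> (\<integral>\<^sup>+x. ennreal (X x) \<partial>N)"
    by (simp add: add.commute ennreal_add_left_cancel_le)
  have lc: "measure N {x \<in> space N. s \<le> X x} * measure N {x \<in> space N. t \<le> X x}
      \<le> (measure N {x \<in> space N. (s + t) / 2 \<le> X x})\<^sup>2" for s t
  proof -
    define f where "f s x = poset_weight V D x * indicator {x \<in> space M. s \<le> X x} x" for s x
    have f: "emeasure N {x \<in> space N. s \<le> X x} = (\<integral>\<^sup>+x. f s x \<partial>M)" for s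
      unfolding space by (simp add: N_def emeasure_density f_def)
    have "(\<integral>\<^sup>+x. f s x \<partial>M) * (\<integral>\<^sup>+x. f t x \<partial>M) \<le> (\<integral>\<^sup>+x. f ((s + t) / 2) x \<partial>M)\<^sup>2"
      unfolding M_def
    proof (rule Prekopa_Leindler_PiM[OF V])
      fix x y :: "'a \<Rightarrow> real"
      define z where "z = (\<lambda>i\<in>V. (x i + y i) / 2)"
      have "z \<in> space M" by (simp add: z_def M_def space_PiM)
      moreover have "X z = (X x + X y) / 2" using uv by (simp add: X_def z_def field_simps)
      ultimately show "f s x * f t y \<le> (f ((s + t) / 2) z)\<^sup>2"
        using poset_weight_log_concave[OF V D, of x y]
        by (auto simp: f_def indicator_def z_def[symmetric])
    qed (unfold M_def[symmetric] f_def, measurable)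
    then have "ennreal (measure N {x \<in> space N. s \<le> X x} * measure N {x \<in> space N. t \<le> X x})
        \<le> ennreal ((measure N {x \<in> space N. (s + t) / 2 \<le> X x})\<^sup>2)"
      by (simp add: f[symmetric] N.emeasure_eq_measure ennreal_mult ennreal_power)
    then show ?thesis by (subst (asm) ennreal_le_iff) auto
  qed
  have "measure N (space N) \<le> 4 * measure N {x \<in> space N. 0 \<le> X x}"
    using N.finite_measure_axioms _ mean_X fin_neg lc
    by (rule measure_nonneg_ge_quarter) measurable
  then show ?thesis
    using total before by (simp add: space measure_def)
qed simp

section \<open>Runs of the algorithm\<close>

lemma run_bind_alg:
  "run \<O> (bind_alg A k) =
     bind_pmf (run \<O> A) (\<lambda>(r, q). map_pmf (\<lambda>(s, q'). (s, q + q')) (run \<O> (k r)))"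
proof (induction A)
  case (Return r)
  then show ?case by (simp add: bind_return_pmf)
next
  case (Query e f)
  then show ?case
    by (simp add: bind_map_pmf map_bind_pmf pmf.map_comp case_prod_beta o_def)
next
  case (Random p)
  then show ?case
    by (simp add: join_pmf_def bind_map_pmf bind_assoc_pmf cong: bind_pmf_cong)
qed

lemma run_query_all: "run \<O> (query_all es) = return_pmf (map \<O> es, length es)"
  by (induction es) (auto simp: run_bind_alg bind_return_pmf)

lemma measure_replicate_pmf_subset:
  "measure (replicate_pmf k p) {es. set es \<subseteq> A} = measure p A ^ k"
proof (induction k)
  case (Suc k)
  have "emeasure (replicate_pmf (Suc k) p) {es. set es \<subseteq> A}
      = (\<integral>\<^sup>+x. \<integral>\<^sup>+xs. indicator A x * indicator {es. set es \<subseteq> A} xs \<partial>replicate_pmf k p \<partial>p)"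
    by (auto simp: indicator_def intro!: nn_integral_cong)
  also have "\<dots> = emeasure p A * emeasure (replicate_pmf k p) {es. set es \<subseteq> A}"
    by (simp add: nn_integral_cmult nn_integral_multc)
  finally show ?case
    using Suc by (simp add: measure_pmf.emeasure_eq_measure ennreal_mult[symmetric])
qed simp

lemma precedes_asym: "precedes \<sigma> u v \<Longrightarrow> \<not> precedes \<sigma> v u"
  by (simp add: precedes_def)

lemma order_oracle_eq:
  assumes "precedes xs u v"
  shows "order_oracle xs {u, v} = (u, v)"
  unfolding order_oracle_def
proof (rule the_equality)
  fix p assume "{u, v} = {fst p, snd p} \<and> precedes xs (fst p) (snd p)"
  then show "p = (u, v)"
    using precedes_asym[OF assms] by (cases p) (auto simp: doubleton_eq_iff)
qed (use assms in auto)

lemma sorted_precedes_le: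
  assumes "distinct \<sigma>" "sorted (map f \<sigma>)" "u \<in> set \<sigma>" "v \<in> set \<sigma>" "precedes \<sigma> u v"
  shows "f u \<le> f v"
proof -
  obtain i j where ij: "i < length \<sigma>" "u = \<sigma> ! i" "j < length \<sigma>" "v = \<sigma> ! j"
    using assms by (metis in_set_conv_nth)
  then have "i < j" using assms by (simp add: precedes_nth_iff)
  then show ?thesis using sorted_nth_mono[OF assms(2), of i j] ij by simp
qed

locale sorting =
  fixes V :: "'v set" and E :: "'v set set" and xs :: "'v list"
  assumes inst: "sorting_instance V E xs"
begin

lemma finite_V: "finite V" and V_nonempty: "V \<noteq> {}" and xs_perm: "xs \<in> permutations_of_set V"
  and edge: "e \<in> E \<Longrightarrow> e \<subseteq> V" "e \<in> E \<Longrightarrow> card e = 2"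
  and path: "Suc i < length xs \<Longrightarrow> {xs ! i, xs ! Suc i} \<in> E"
  using inst by (auto simp: sorting_instance_def)

lemma xs: "set xs = V" "distinct xs" "length xs = card V"
  using xs_perm by (auto dest: permutations_of_setD simp: length_finite_permutations_of_set)

lemma finite_E: "finite E"
  using finite_V edge(1) by (auto intro: finite_subset[of E "Pow V"])

lemma edge_cases:
  assumes "e \<in> E" "\<sigma> \<in> permutations_of_set V"
  obtains u v where "e = {u, v}" "u \<in> V" "v \<in> V" "u \<noteq> v" "precedes \<sigma> u v"
proof -
  obtain u v where uv: "e = {u, v}" "u \<noteq> v" using edge(2)[OF assms(1)] by (auto simp: card_2_iff)
  then have "u \<in> V" "v \<in> V" using edge(1)[OF assms(1)] by auto
  moreover have "precedes \<sigma> u v \<or> precedes \<sigma> v u"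
    using assms(2) uv calculation by (intro precedes_total) (auto dest: permutations_of_setD)
  ultimately show ?thesis using uv that by (metis doubleton_eq_iff)
qed

lemma is_orientation_orient_by:
  assumes "\<sigma> \<in> permutations_of_set V"
  shows "is_orientation E (orient_by \<sigma> E)"
proof -
  have "(u, v) \<in> orient_by \<sigma> E \<longleftrightarrow> (v, u) \<notin> orient_by \<sigma> E" if "{u, v} \<in> E" for u v
  proof -
    have "precedes \<sigma> u v \<longleftrightarrow> \<not> precedes \<sigma> v u"
      using edge_cases[OF that assms] precedes_asym by (metis doubleton_eq_iff)
    moreover have "{v, u} \<in> E" using that by (simp add: insert_commute)
    ultimately show ?thesis using that by (simp add: orient_by_def)
  qed
  moreover have "\<forall>(u, v)\<in>orient_by \<sigma> E. {u, v} \<in> E" by (auto simp: orient_by_def)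
  ultimately show ?thesis unfolding is_orientation_def by blast
qed

lemma orient_by_subset: "orient_by \<sigma> E \<subseteq> V \<times> V"
  using edge(1) by (auto simp: orient_by_def)

lemma order_oracle_in:
  assumes "e \<in> E"
  shows "order_oracle xs e \<in> orient_by xs E"
proof -
  obtain u v where "e = {u, v}" "precedes xs u v" using edge_cases[OF assms xs_perm] .
  then show ?thesis using assms by (auto simp: order_oracle_eq orient_by_def)
qed

lemma xs_compatible: "D \<subseteq> orient_by xs E \<Longrightarrow> xs \<in> compatible V D"
  using xs_perm by (auto simp: compatible_def orient_by_def)

lemma compatible_orient_by: "compatible V (orient_by xs E) = {xs}"
proof -
  have "\<sigma> = xs" if "\<sigma> \<in> compatible V (orient_by xs E)" for \<sigma>
  proof (rule chain_unique)
    have \<sigma>: "set \<sigma> = V" "distinct \<sigma>" "\<And>u v. (u, v) \<in> orient_by xs E \<Longrightarrow> precedes \<sigma> u v"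
      using that by (auto simp: compatible_def dest: permutations_of_setD)
    let ?x = "\<lambda>v. real (vrank \<sigma> v)"
    have "sorted_wrt (<) (map ?x \<sigma>)" using \<sigma>(2) by (simp add: sorted_wrt_iff_nth_less vrank_nth)
    then show "chain \<sigma> ?x" by (auto simp: chain_def vrank_def)
    show "set \<sigma> = set xs" using \<sigma> xs by simp
    show "inj_on ?x (set \<sigma>)"
      using \<sigma>(2) by (auto simp: inj_on_def in_set_conv_nth vrank_nth)
    have "vrank \<sigma> (xs ! i) < vrank \<sigma> (xs ! Suc i)" if "Suc i < length xs" for i
      using \<sigma>(3)[of "xs ! i" "xs ! Suc i"] path[OF that] that xs
      by (auto simp: orient_by_def precedes_nth_iff) (simp add: precedes_def)
    then have "sorted_wrt (<) (map ?x xs)"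
      by (subst sorted_wrt_iff_nth_Suc_transp) (auto intro: transpI)
    then show "chain xs ?x" by (auto simp: chain_def vrank_def)
  qed
  then show ?thesis using xs_compatible[of "orient_by xs E"] by auto
qed

lemma card_le_card_E: "card V \<le> Suc (card E)"
proof -
  have "inj_on (\<lambda>i. {xs ! i, xs ! Suc i}) {..<card V - 1}"
  proof (rule inj_onI)
    fix i j assume "i \<in> {..<card V - 1}" "j \<in> {..<card V - 1}" "{xs ! i, xs ! Suc i} = {xs ! j, xs ! Suc j}"
    then show "i = j" using xs by (auto simp: doubleton_eq_iff nth_eq_iff_index_eq)
  qed
  then have "card {..<card V - 1} \<le> card E"
    using path xs finite_E by (intro card_inj_on_le) auto
  then show ?thesis by simp
qed

lemma mispredicted_edge_shrinks:
  assumes ord: "is_avg_rank_order V ord" and D: "D \<subseteq> orient_by xs E" "D' \<subseteq> orient_by xs E" "D \<subseteq> D'"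
    and e: "e \<in> E" "order_oracle xs e \<notin> orient_by (ord D) E" "order_oracle xs e \<in> D'"
  shows "4 * card (compatible V D') \<le> 3 * card (compatible V D)"
proof -
  have perm: "ord D \<in> permutations_of_set V" and srt: "sorted (map (avg_rank V D) (ord D))"
    using ord by (auto simp: is_avg_rank_order_def)
  obtain u v where uv: "e = {u, v}" "u \<in> V" "v \<in> V" "u \<noteq> v" "precedes (ord D) u v"
    using edge_cases[OF e(1) perm] .
  have "precedes xs v u"
  proof (rule ccontr)
    assume "\<not> precedes xs v u"
    then have "precedes xs u v" using precedes_total[of xs u v] xs uv by auto
    then have "order_oracle xs e = (u, v)" using uv order_oracle_eq by metis
    then show False using e uv by (simp add: orient_by_def)
  qed
  then have answer: "order_oracle xs e = (v, u)"
    using uv order_oracle_eq[of xs v u] by (simp add: insert_commute)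
  have "avg_rank V D u \<le> avg_rank V D v"
    using sorted_precedes_le[OF _ srt _ _ uv(5)] perm uv by (auto dest: permutations_of_setD)
  then have quarter: "card (compatible V D) \<le> 4 * card {\<sigma> \<in> compatible V D. precedes \<sigma> u v}"
    using D(1) orient_by_subset uv finite_V by (intro card_compatible_le_4_card_precedes) blast+
  have fin: "finite (compatible V D)" using finite_V by (rule finite_compatible)
  have "\<not> precedes \<sigma> u v" "\<sigma> \<in> compatible V D" if "\<sigma> \<in> compatible V D'" for \<sigma>
    using that e(3) D(3) precedes_asym[of \<sigma> v u] unfolding answer by (auto simp: compatible_def)
  then have "card (compatible V D') \<le> card (compatible V D - {\<sigma> \<in> compatible V D. precedes \<sigma> u v})"
    using fin by (intro card_mono) auto
  also have "\<dots> = card (compatible V D) - card {\<sigma> \<in> compatible V D. precedes \<sigma> u v}"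
    using fin by (intro card_Diff_subset) auto
  finally show ?thesis using quarter by linarith
qed

lemma prob_all_predicted_le:
  assumes \<sigma>: "\<sigma> \<in> permutations_of_set V" and E: "E \<noteq> {}"
    and w: "w \<le> real (card (orient_by \<sigma> E - orient_by xs E))"
  shows "measure (replicate_pmf k (pmf_of_set E)) {es. order_oracle xs ` set es \<subseteq> orient_by \<sigma> E}
    \<le> exp (- (real k * w / real (card E)))"
proof -
  define P where "P = orient_by \<sigma> E"
  define good bad where "good = {e \<in> E. order_oracle xs e \<in> P}" and "bad = {e \<in> E. order_oracle xs e \<notin> P}"
  have m: "real (card E) > 0" using E finite_E by (simp add: card_gt_0_iff)
  have "card (P - orient_by xs E) \<le> card bad"
  proof (rule card_inj_on_le)
    show "inj_on (\<lambda>(u, v). {u, v}) (P - orient_by xs E)"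
      by (auto simp: inj_on_def P_def orient_by_def doubleton_eq_iff dest: precedes_asym)
    show "(\<lambda>(u, v). {u, v}) ` (P - orient_by xs E) \<subseteq> bad"
    proof clarify
      fix u v assume uv: "(u, v) \<in> P" "(u, v) \<notin> orient_by xs E"
      then have edge: "{u, v} \<in> E" and "\<not> precedes xs u v" by (auto simp: P_def orient_by_def)
      then have "precedes xs v u"
        using edge_cases[OF edge xs_perm] by (metis doubleton_eq_iff)
      then have "order_oracle xs {u, v} = (v, u)" using order_oracle_eq by (metis insert_commute)
      moreover have "(v, u) \<notin> P" using uv by (auto simp: P_def orient_by_def dest: precedes_asym)
      ultimately show "{u, v} \<in> bad" using edge by (simp add: bad_def)
    qed
  qed (use finite_E in \<open>auto simp: bad_def\<close>)
  moreover have "card good + card bad = card E"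
    using finite_E by (subst card_Un_disjoint[symmetric]) (auto simp: good_def bad_def intro!: arg_cong[where f = card])
  ultimately have good: "real (card good) \<le> real (card E) - w" using w by (simp add: P_def)
  have "measure (replicate_pmf k (pmf_of_set E)) {es. order_oracle xs ` set es \<subseteq> P}
      = measure (pmf_of_set E) {e. order_oracle xs e \<in> P} ^ k"
    using measure_replicate_pmf_subset[of k "pmf_of_set E" "{e. order_oracle xs e \<in> P}"]
    by (simp add: image_subset_iff subset_eq)
  also have "measure (pmf_of_set E) {e. order_oracle xs e \<in> P} = real (card good) / real (card E)"
    using E finite_E by (simp add: measure_pmf_of_set good_def Int_def)
  also have "\<dots> ^ k \<le> exp (- (w / real (card E))) ^ k"
  proof (rule power_mono)
    have "real (card good) / real (card E) \<le> 1 + - (w / real (card E))" using good m by (simp add: field_simps)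
    also have "\<dots> \<le> exp (- (w / real (card E)))" by (rule exp_ge_add_one_self)
    finally show "real (card good) / real (card E) \<le> exp (- (w / real (card E)))" .
  qed simp
  also have "\<dots> = exp (- (real k * w / real (card E)))" by (simp add: exp_of_nat_mult[symmetric])
  finally show ?thesis by (simp add: P_def)
qed

end

locale sparse_sort = sorting V E xs
  for V :: "'v set" and E :: "'v set set" and xs :: "'v list" +
  fixes c d K0 C0 :: real and PS :: "'v prediction_alg" and ord :: "('v \<times> 'v) set \<Rightarrow> 'v list"
  assumes ord: "is_avg_rank_order V ord" and PS: "prediction_sort d K0 C0 PS" and c: "c \<ge> 0"
begin

definition n :: real where "n = real (card V)"
definition m :: real where "m = real (card E)"
definition a :: nat where "a = nat \<lceil>(1 + c) * sqrt (m / n)\<rceil>"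
definition w :: real where "w = sqrt (m * n) * ln n"
definition pred :: "('v \<times> 'v) set \<Rightarrow> ('v \<times> 'v) set" where "pred D = orient_by (ord D) E"
definition rounds :: "('v \<times> 'v) set \<Rightarrow> ('v list \<times> nat) spmf" where
  "rounds D = run_rounds (order_oracle xs) (sparse_sort_round c PS ord V E) D"
definition budget :: real where "budget = \<bar>K0\<bar> * (w + n * ln n)"

lemma n_ge_1: "n \<ge> 1"
  using finite_V V_nonempty by (simp add: n_def card_gt_0_iff Suc_le_eq)

lemma w_nonneg: "0 \<le> w"
  using n_ge_1 by (simp add: w_def m_def)

lemma budget_nonneg: "0 \<le> budget"
  using n_ge_1 w_nonneg by (simp add: budget_def)

lemma ord_perm: "ord D \<in> permutations_of_set V"
  using ord by (simp add: is_avg_rank_order_def)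

lemma rounds_step:
  assumes "card (compatible V D) \<noteq> 1"
  shows "rounds D = bind_pmf (replicate_pmf a (pmf_of_set E)) (\<lambda>es.
    if order_oracle xs ` set es \<subseteq> pred D
    then map_pmf (\<lambda>(D', q). Some (the_elem (compatible V D'), a + q)) (run (order_oracle xs) (PS V E (pred D) w))
    else map_spmf (\<lambda>(r, q). (r, a + q)) (rounds (D \<union> (order_oracle xs ` set es - pred D))))"
proof -
  have "rounds D = bind_pmf (replicate_pmf a (pmf_of_set E)) (\<lambda>es.
    if order_oracle xs ` set es \<subseteq> pred D
    then map_pmf (\<lambda>(D', q). Some (the_elem (compatible V D'), length es + q)) (run (order_oracle xs) (PS V E (pred D) w))
    else map_spmf (\<lambda>(r, q). (r, length es + q)) (rounds (D \<union> (order_oracle xs ` set es - pred D))))"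
    using assms unfolding rounds_def
    by (subst run_rounds.simps)
      (auto simp: sparse_sort_round_def Let_def a_def[unfolded m_def n_def] w_def[unfolded m_def n_def] pred_def
        join_pmf_def run_bind_alg run_query_all bind_return_pmf bind_map_pmf bind_assoc_pmf map_pmf_def
        case_prod_beta intro!: bind_pmf_cong)
  also have "\<dots> = bind_pmf (replicate_pmf a (pmf_of_set E)) (\<lambda>es.
    if order_oracle xs ` set es \<subseteq> pred D
    then map_pmf (\<lambda>(D', q). Some (the_elem (compatible V D'), a + q)) (run (order_oracle xs) (PS V E (pred D) w))
    else map_spmf (\<lambda>(r, q). (r, a + q)) (rounds (D \<union> (order_oracle xs ` set es - pred D))))"
    by (intro bind_pmf_cong refl) (auto simp: set_replicate_pmf)
  finally show ?thesis .
qed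

lemma rounds_done:
  assumes "D \<subseteq> orient_by xs E" "card (compatible V D) = 1"
  shows "rounds D = return_spmf (xs, 0)"
proof -
  have "the_elem (compatible V D) = xs"
    using assms xs_compatible[OF assms(1)] by (auto simp: card_1_singleton_iff)
  then show ?thesis
    using assms unfolding rounds_def by (subst run_rounds.simps) (simp add: sparse_sort_round_def)
qed

lemma next_state:
  assumes D: "D \<subseteq> orient_by xs E" and es: "set es \<subseteq> E" "\<not> order_oracle xs ` set es \<subseteq> pred D"
    and le: "real (card (compatible V D)) \<le> (4 / 3) ^ Suc N"
  shows "D \<union> (order_oracle xs ` set es - pred D) \<subseteq> orient_by xs E"
    and "real (card (compatible V (D \<union> (order_oracle xs ` set es - pred D)))) \<le> (4 / 3) ^ N"
proof -
  let ?D' = "D \<union> (order_oracle xs ` set es - pred D)"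
  show D': "?D' \<subseteq> orient_by xs E" using D es(1) order_oracle_in by auto
  obtain e where "e \<in> set es" "order_oracle xs e \<notin> pred D" using es(2) by blast
  then have "4 * card (compatible V ?D') \<le> 3 * card (compatible V D)"
    using es(1) D D' by (intro mispredicted_edge_shrinks[OF ord, of _ _ e]) (auto simp: pred_def)
  then have "4 * real (card (compatible V ?D')) \<le> 3 * real (card (compatible V D))" by linarith
  then show "real (card (compatible V ?D')) \<le> (4 / 3) ^ N" using le by simp
qed

lemma rounds_cases:
  assumes "D \<subseteq> orient_by xs E" "real (card (compatible V D)) \<le> (4 / 3) ^ N"
  obtains "rounds D = return_spmf (xs, 0)" | N' where "N = Suc N'" "card (compatible V D) \<noteq> 1"
proof (cases "card (compatible V D) = 1")
  case False
  have "card (compatible V D) \<noteq> 0"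
    using xs_compatible[OF assms(1)] finite_compatible[OF finite_V] by auto
  then have "N \<noteq> 0" using assms(2) False by (intro notI) auto
  then show ?thesis using False that(2) not0_implies_Suc by blast
qed (use rounds_done[OF assms(1)] that(1) in auto)

lemma E_nonempty:
  assumes "card (compatible V D) \<noteq> 1" "D \<subseteq> orient_by xs E"
  shows "E \<noteq> {}" "2 \<le> card V"
proof -
  show "2 \<le> card V"
  proof (rule ccontr)
    assume "\<not> 2 \<le> card V"
    then have "card V = 1" using n_ge_1 by (simp add: n_def)
    then have "card (permutations_of_set V) = 1" using finite_V by simp
    then obtain \<sigma> where "permutations_of_set V = {\<sigma>}" by (auto simp: card_1_singleton_iff)
    then have "compatible V D = {xs}" using xs_perm xs_compatible[OF assms(2)] by (auto simp: compatible_def)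
    then show False using assms(1) by simp
  qed
  then show "E \<noteq> {}" using card_le_card_E by auto
qed

lemma rounds_within_budget:
  assumes budget: "within_query_budget K0 PS"
    and "D \<subseteq> orient_by xs E" "real (card (compatible V D)) \<le> (4 / 3) ^ N"
    and "r \<in> set_pmf (rounds D)"
  shows "\<exists>ys q. r = Some (ys, q) \<and> real q \<le> real (N * a) + budget"
  using assms(2-)
proof (induction N arbitrary: D r)
  case 0
  then show ?case using budget_nonneg by (cases rule: rounds_cases[OF 0(1,2)]) auto
next
  case (Suc N)
  show ?case
  proof (cases rule: rounds_cases[OF Suc.prems(1,2)])
    case 1
    then show ?thesis using Suc.prems budget_nonneg by auto
  next
    case 2
    note E = E_nonempty[OF 2(2) Suc.prems(1)]
    obtain es where es: "es \<in> set_pmf (replicate_pmf a (pmf_of_set E))"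
      and r: "r \<in> set_pmf (if order_oracle xs ` set es \<subseteq> pred D
        then map_pmf (\<lambda>(D', q). Some (the_elem (compatible V D'), a + q)) (run (order_oracle xs) (PS V E (pred D) w))
        else map_spmf (\<lambda>(r, q). (r, a + q)) (rounds (D \<union> (order_oracle xs ` set es - pred D))))"
      using Suc.prems(3) unfolding rounds_step[OF 2(2)] by auto
    have esE: "set es \<subseteq> E" using es E finite_E by (auto simp: set_replicate_pmf)
    show ?thesis
    proof (cases "order_oracle xs ` set es \<subseteq> pred D")
      case True
      then obtain D' q where q: "(D', q) \<in> set_pmf (run (order_oracle xs) (PS V E (pred D) w))"
        and r': "r = Some (the_elem (compatible V D'), a + q)" using r by auto
      have "real q \<le> K0 * (w + n * ln n)"
        using budget q inst is_orientation_orient_by[OF ord_perm] w_nonneg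
        unfolding within_query_budget_def n_def pred_def by blast
      also have "\<dots> \<le> budget"
        unfolding budget_def using w_nonneg n_ge_1 by (intro mult_right_mono) auto
      also have "\<dots> \<le> real (N * a) + budget" by simp
      finally show ?thesis using r' by simp
    next
      case False
      then obtain r' where r': "r' \<in> set_pmf (rounds (D \<union> (order_oracle xs ` set es - pred D)))"
        "r = map_option (\<lambda>(r, q). (r, a + q)) r'" using r by auto
      show ?thesis
        using Suc.IH[OF next_state[OF Suc.prems(1) esE False Suc.prems(2)] r'(1)] r'(2) by (auto simp: algebra_simps)
    qed
  qed
qed

definition good :: "real \<Rightarrow> ('v list \<times> nat) option set" where
  "good t = Some ` {(ys, q). ys = xs \<and> real q \<le> t}"

lemma good_iff: "r \<in> good t \<longleftrightarrow> (\<exists>q. r = Some (xs, q) \<and> real q \<le> t)"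
  by (auto simp: good_def)

lemma good_mono: "s \<le> t \<Longrightarrow> good s \<subseteq> good t"
  by (auto simp: good_def)

lemma run_PS_failure:
  assumes "real (card (pred D - orient_by xs E)) \<le> w"
  shows "emeasure (map_pmf (\<lambda>(D', q). Some (the_elem (compatible V D'), a + q))
      (run (order_oracle xs) (PS V E (pred D) w))) (- good (real a + budget))
    \<le> ennreal (\<bar>C0\<bar> * n powr - d)"
proof -
  let ?R = "run (order_oracle xs) (PS V E (pred D) w)"
  let ?A = "{(D', q). D' = orient_by xs E \<and> real q \<le> K0 * (w + n * ln n)}"
  have "K0 * (w + n * ln n) \<le> budget"
    unfolding budget_def using w_nonneg n_ge_1 by (intro mult_right_mono) auto
  then have "(\<lambda>(D', q). Some (the_elem (compatible V D'), a + q)) -` (- good (real a + budget)) \<subseteq> - ?A"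
    by (auto simp: good_iff compatible_orient_by)
  then have "measure ?R ((\<lambda>(D', q). Some (the_elem (compatible V D'), a + q)) -` (- good (real a + budget)))
      \<le> measure ?R (- ?A)" by (intro measure_pmf.finite_measure_mono) auto
  also have "\<dots> = 1 - measure ?R ?A"
    using measure_pmf.prob_compl[of ?A ?R] by (simp add: Compl_eq_Diff_UNIV)
  also have "\<dots> \<le> C0 * n powr - d"
    using PS inst is_orientation_orient_by[OF ord_perm, of D] assms
    unfolding prediction_sort_def n_def pred_def by fastforce
  also have "\<dots> \<le> \<bar>C0\<bar> * n powr - d" by (intro mult_right_mono) auto
  finally show ?thesis by (simp add: measure_pmf.emeasure_eq_measure ennreal_leI)
qed

lemma prob_wrong_prediction_passes:
  assumes "w < real (card (pred D - orient_by xs E))" "E \<noteq> {}"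
  shows "measure (replicate_pmf a (pmf_of_set E)) {es. order_oracle xs ` set es \<subseteq> pred D} \<le> n powr - (1 + c)"
proof -
  have m: "m > 0" using assms(2) finite_E by (simp add: m_def card_gt_0_iff)
  have n: "n > 0" using n_ge_1 by simp
  have "m = sqrt (m / n) * sqrt (m * n)" using m n by (simp add: real_sqrt_mult[symmetric])
  then have "(1 + c) * ln n = (1 + c) * sqrt (m / n) * w / m"
    using m by (simp add: w_def field_simps)
  also have "\<dots> \<le> real a * w / m"
    using w_nonneg m unfolding a_def by (intro divide_right_mono mult_right_mono real_nat_ceiling_ge) auto
  finally have "exp (- (real a * w / m)) \<le> n powr - (1 + c)"
    using n by (simp add: powr_def algebra_simps)
  then show ?thesis
    using prob_all_predicted_le[OF ord_perm assms(2), of w D a] assms(1) by (simp add: pred_def m_def)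
qed

lemma rounds_failure:
  assumes "D \<subseteq> orient_by xs E" "real (card (compatible V D)) \<le> (4 / 3) ^ N"
  shows "emeasure (rounds D) (- good (real (N * a) + budget))
    \<le> ennreal (real N * n powr - (1 + c) + \<bar>C0\<bar> * n powr - d)"
  using assms
proof (induction N arbitrary: D)
  case 0
  then show ?case
    using budget_nonneg by (cases rule: rounds_cases[OF 0(1,2)]) (auto simp: good_iff indicator_def)
next
  case (Suc N)
  let ?\<epsilon> = "n powr - (1 + c)" and ?\<delta> = "\<bar>C0\<bar> * n powr - d" and ?G = "good (real (Suc N * a) + budget)"
  let ?pass = "{es. order_oracle xs ` set es \<subseteq> pred D}"
  show ?case
  proof (cases rule: rounds_cases[OF Suc.prems(1,2)])
    case 1
    then show ?thesis using budget_nonneg by (auto simp: good_iff indicator_def)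
  next
    case 2
    note E = E_nonempty[OF 2(2) Suc.prems(1)]
    define next_dist where "next_dist es = (if order_oracle xs ` set es \<subseteq> pred D
        then map_pmf (\<lambda>(D', q). Some (the_elem (compatible V D'), a + q)) (run (order_oracle xs) (PS V E (pred D) w))
        else map_spmf (\<lambda>(r, q). (r, a + q)) (rounds (D \<union> (order_oracle xs ` set es - pred D))))" for es
    have fail: "emeasure (next_dist es) (- ?G) \<le> ennreal (real N * ?\<epsilon> + ?\<delta>)"
      if "es \<in> set_pmf (replicate_pmf a (pmf_of_set E))" "es \<notin> ?pass" for es
    proof -
      let ?D' = "D \<union> (order_oracle xs ` set es - pred D)"
      have "set es \<subseteq> E" using that E finite_E by (auto simp: set_replicate_pmf)
      note next_state[OF Suc.prems(1) this _ Suc.prems(2)]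
      then have "emeasure (rounds ?D') (- good (real (N * a) + budget)) \<le> ennreal (real N * ?\<epsilon> + ?\<delta>)"
        using that(2) by (intro Suc.IH) auto
      moreover have "map_option (\<lambda>(r, q). (r, a + q)) -` (- ?G) \<subseteq> - good (real (N * a) + budget)"
        by (auto simp: good_iff algebra_simps)
      then have "emeasure (next_dist es) (- ?G) \<le> emeasure (rounds ?D') (- good (real (N * a) + budget))"
        using that(2) by (auto simp: next_dist_def intro!: emeasure_mono)
      ultimately show ?thesis by (rule order_trans[rotated])
    qed
    have eps: "0 \<le> ?\<epsilon>" "0 \<le> ?\<delta>" by auto
    have "emeasure (rounds D) (- ?G) = (\<integral>\<^sup>+es. emeasure (next_dist es) (- ?G) \<partial>replicate_pmf a (pmf_of_set E))"
      unfolding rounds_step[OF 2(2)] next_dist_def by simp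
    also have "\<dots> \<le> ennreal (real (Suc N) * ?\<epsilon> + ?\<delta>)"
    proof (cases "real (card (pred D - orient_by xs E)) \<le> w")
      case True
      have "emeasure (next_dist es) (- ?G) \<le> ennreal (real (Suc N) * ?\<epsilon> + ?\<delta>)"
        if es: "es \<in> set_pmf (replicate_pmf a (pmf_of_set E))" for es
      proof (cases "es \<in> ?pass")
        case pass: True
        have "real a \<le> real (Suc N * a)" by simp
        then have "- ?G \<subseteq> - good (real a + budget)"
          by (intro Compl_anti_mono good_mono add_right_mono)
        then have "emeasure (next_dist es) (- ?G) \<le> emeasure (next_dist es) (- good (real a + budget))"
          by (intro emeasure_mono) auto
        also have "\<dots> \<le> ennreal ?\<delta>" using run_PS_failure[OF True] pass by (simp add: next_dist_def)
        also have "\<dots> \<le> ennreal (real (Suc N) * ?\<epsilon> + ?\<delta>)" by (intro ennreal_leI) simp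
        finally show ?thesis .
      next
        case False
        note fail[OF es this]
        also have "ennreal (real N * ?\<epsilon> + ?\<delta>) \<le> ennreal (real (Suc N) * ?\<epsilon> + ?\<delta>)"
          by (intro ennreal_leI) (simp add: algebra_simps)
        finally show ?thesis .
      qed
      then have "(\<integral>\<^sup>+es. emeasure (next_dist es) (- ?G) \<partial>replicate_pmf a (pmf_of_set E))
          \<le> (\<integral>\<^sup>+es. ennreal (real (Suc N) * ?\<epsilon> + ?\<delta>) \<partial>replicate_pmf a (pmf_of_set E))"
        by (intro nn_integral_mono_AE) (auto simp: AE_measure_pmf_iff)
      then show ?thesis by simp
    next
      case False
      have "emeasure (next_dist es) (- ?G) \<le> ennreal (real N * ?\<epsilon> + ?\<delta>) + indicator ?pass es"
        if es: "es \<in> set_pmf (replicate_pmf a (pmf_of_set E))" for es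
      proof (cases "es \<in> ?pass")
        case True
        have "emeasure (next_dist es) (- ?G) \<le> 1" by (rule measure_pmf.emeasure_le_1)
        then show ?thesis using True by (simp add: add_increasing)
      qed (use fail[OF es] in simp)
      then have "(\<integral>\<^sup>+es. emeasure (next_dist es) (- ?G) \<partial>replicate_pmf a (pmf_of_set E))
          \<le> (\<integral>\<^sup>+es. ennreal (real N * ?\<epsilon> + ?\<delta>) + indicator ?pass es \<partial>replicate_pmf a (pmf_of_set E))"
        by (intro nn_integral_mono_AE) (auto simp: AE_measure_pmf_iff)
      also have "\<dots> = ennreal (real N * ?\<epsilon> + ?\<delta>) + emeasure (replicate_pmf a (pmf_of_set E)) ?pass"
        by (subst nn_integral_add) auto
      also have "\<dots> \<le> ennreal (real N * ?\<epsilon> + ?\<delta>) + ennreal ?\<epsilon>"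
        using prob_wrong_prediction_passes[of D] False E
        by (intro add_left_mono) (auto simp: measure_pmf.emeasure_eq_measure intro!: ennreal_leI)
      also have "\<dots> = ennreal (real (Suc N) * ?\<epsilon> + ?\<delta>)"
        using eps by (subst ennreal_plus[symmetric]) (auto simp: algebra_simps)
      finally show ?thesis .
    qed
    finally show ?thesis .
  qed
qed

definition max_rounds :: nat where "max_rounds = nat \<lceil>4 * (n * ln n)\<rceil>"

lemma compatible_empty_le: "real (card (compatible V {})) \<le> (4 / 3) ^ max_rounds"
proof -
  have n: "0 < n" using n_ge_1 by simp
  have "exp (1 / 4) \<le> (4 / 3 :: real)"
    using exp_ge_add_one_self[of "- (1 / 4) :: real"] by (simp add: exp_minus field_simps)
  then have "exp (1 / 4) ^ max_rounds \<le> (4 / 3 :: real) ^ max_rounds" by (intro power_mono) auto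
  moreover have "exp (1 / 4) ^ max_rounds = exp (real max_rounds / 4)"
    by (simp add: exp_of_nat_mult[symmetric])
  moreover have "4 * (n * ln n) \<le> real max_rounds" unfolding max_rounds_def by (rule real_nat_ceiling_ge)
  then have "exp (n * ln n) \<le> exp (real max_rounds / 4)" by simp
  moreover have "card (compatible V {}) = fact (card V)"
    using finite_V by (simp add: compatible_def)
  then have "real (card (compatible V {})) \<le> real (card V) ^ card V"
    using fact_le_power[of "card V", where 'a = real] by simp
  moreover have "real (card V) ^ card V = exp (n * ln n)"
    using n by (simp add: n_def powr_realpow[symmetric] powr_def)
  ultimately show ?thesis by linarith
qed

lemma n_ln_n_ge_1:
  assumes "2 \<le> card V"
  shows "1 \<le> n * ln n"
proof -
  have n: "2 \<le> n" using assms by (simp add: n_def)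
  have "1 / 2 \<le> ln (2 :: real)" using ln2_ge_two_thirds by linarith
  then have "1 / 2 \<le> ln n" using n ln_mono[of 2 n] by linarith
  then have "2 * (1 / 2) \<le> n * ln n" using n by (intro mult_mono) auto
  then show ?thesis by simp
qed

lemma max_rounds_le:
  assumes "2 \<le> card V"
  shows "real max_rounds \<le> 5 * (n * ln n)"
  using n_ln_n_ge_1[OF assms] unfolding max_rounds_def by linarith

lemma query_bound: "real (max_rounds * a) + budget \<le> (5 * (3 + c) + 3 * \<bar>K0\<bar>) * w"
proof (cases "2 \<le> card V")
  case True
  then have n: "2 \<le> n" by (simp add: n_def)
  have m: "n / 2 \<le> m" "m > 0" using card_le_card_E True by (auto simp: n_def m_def)
  have ln: "0 \<le> ln n" using n by simp
  have "1 / 2 \<le> sqrt (m / n)"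
    using m n by (intro real_le_rsqrt) (simp add: power2_eq_square field_simps)
  then have "(1 + c) * sqrt (m / n) + 1 \<le> (3 + c) * sqrt (m / n)" by (simp add: algebra_simps)
  moreover have "real a \<le> (1 + c) * sqrt (m / n) + 1"
    using c m n by (simp add: a_def)
  ultimately have a: "real a \<le> (3 + c) * sqrt (m / n)" by linarith
  have sqrt: "n * sqrt (m / n) = sqrt (m * n)"
    using n m by (simp add: real_sqrt_divide real_sqrt_mult real_div_sqrt field_simps)
  have "real max_rounds * real a \<le> 5 * (n * ln n) * ((3 + c) * sqrt (m / n))"
    using max_rounds_le[OF True] a n ln c by (intro mult_mono) auto
  also have "\<dots> = 5 * (3 + c) * ((n * sqrt (m / n)) * ln n)" by (simp add: algebra_simps)
  also have "\<dots> = 5 * (3 + c) * w" by (simp only: sqrt w_def)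
  finally have "real (max_rounds * a) \<le> 5 * (3 + c) * w" by simp
  moreover have "n / 2 \<le> sqrt (m * n)"
  proof (rule real_le_rsqrt)
    have "n / 2 * (n / 2) \<le> m * n" using m n by (intro mult_mono) auto
    then show "(n / 2)\<^sup>2 \<le> m * n" by (simp add: power2_eq_square)
  qed
  then have "n / 2 * ln n \<le> w" unfolding w_def using ln by (rule mult_right_mono)
  then have "w + n * ln n \<le> 3 * w" by linarith
  then have "budget \<le> \<bar>K0\<bar> * (3 * w)" unfolding budget_def by (intro mult_left_mono) auto
  ultimately show ?thesis by (simp add: algebra_simps)
next
  case False
  then have "n = 1" using n_ge_1 by (simp add: n_def)
  then show ?thesis by (simp add: max_rounds_def budget_def w_def)
qed

lemma failure_bound:
  assumes "1 + d \<le> c"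
  shows "real max_rounds * n powr - (1 + c) \<le> 5 * n powr - d"
proof (cases "2 \<le> card V")
  case True
  have n: "0 < n" "1 \<le> n" using n_ge_1 by auto
  have "ln n \<le> n" using n ln_le_minus_one[of n] by linarith
  then have "real max_rounds \<le> 5 * (n * n)"
    using max_rounds_le[OF True] mult_left_mono[of "ln n" n n] n by linarith
  also have "n * n = n powr 2" using n by (simp add: powr_numeral power2_eq_square)
  finally have "real max_rounds * n powr - (1 + c) \<le> 5 * n powr 2 * n powr - (1 + c)"
    by (intro mult_right_mono) auto
  also have "\<dots> = 5 * n powr (1 - c)" by (simp add: powr_add[symmetric])
  also have "\<dots> \<le> 5 * n powr - d" using n assms by (intro mult_left_mono powr_mono) auto
  finally show ?thesis .
next
  case False
  then have "n = 1" using n_ge_1 by (simp add: n_def)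
  then show ?thesis by (simp add: max_rounds_def)
qed

lemma sparse_generalized_sort_correct:
  assumes "1 + d \<le> c"
  shows "1 - (5 + \<bar>C0\<bar>) * n powr - d \<le> measure (measure_spmf (rounds {}))
    {(ys, q). ys = xs \<and> real q \<le> (5 * (3 + c) + 3 * \<bar>K0\<bar>) * w}"
proof -
  let ?t = "real (max_rounds * a) + budget" and ?K = "5 * (3 + c) + 3 * \<bar>K0\<bar>"
  have "ennreal (measure (rounds {}) (- good ?t))
      \<le> ennreal (real max_rounds * n powr - (1 + c) + \<bar>C0\<bar> * n powr - d)"
    using rounds_failure[OF _ compatible_empty_le] by (simp add: measure_pmf.emeasure_eq_measure)
  then have "measure (rounds {}) (- good ?t) \<le> real max_rounds * n powr - (1 + c) + \<bar>C0\<bar> * n powr - d"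
    by (subst (asm) ennreal_le_iff) auto
  also have "\<dots> \<le> (5 + \<bar>C0\<bar>) * n powr - d" using failure_bound[OF assms] by (simp add: distrib_right)
  finally have "1 - (5 + \<bar>C0\<bar>) * n powr - d \<le> measure (rounds {}) (good ?t)"
    using measure_pmf.prob_compl[of "good ?t" "rounds {}"] by (simp add: Compl_eq_Diff_UNIV)
  also have "\<dots> \<le> measure (rounds {}) (good (?K * w))"
    using query_bound by (intro measure_pmf.finite_measure_mono good_mono) auto
  finally show ?thesis by (simp add: measure_measure_spmf_conv_measure_pmf good_def)
qed

lemma sparse_generalized_sort_budget:
  assumes "within_query_budget K0 PS"
  shows "lossless_spmf (rounds {})"
    and "(ys, q) \<in> set_spmf (rounds {}) \<Longrightarrow> real q \<le> (5 * (3 + c) + 3 * \<bar>K0\<bar>) * w"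
proof -
  note * = rounds_within_budget[OF assms _ compatible_empty_le]
  have "None \<notin> set_pmf (rounds {})" using *[of None] by auto
  then show "lossless_spmf (rounds {})" by (simp add: lossless_iff_set_pmf_None)
  show "real q \<le> (5 * (3 + c) + 3 * \<bar>K0\<bar>) * w" if "(ys, q) \<in> set_spmf (rounds {})"
    using *[of "Some (ys, q)"] that query_bound by (auto simp: in_set_spmf)
qed

end

theorem theorem6:
  fixes d :: real
  assumes "d > 0"
  shows "\<exists>c0>0. \<forall>c\<ge>c0. \<forall>K0 C0. \<exists>K C.
    \<forall>(PS :: 'v prediction_alg) V E xs ord.
      prediction_sort d K0 C0 PS \<longrightarrow>
      sorting_instance V E xs \<longrightarrow>
      is_avg_rank_order V ord \<longrightarrow>
      (let n = real (card V);
           m = real (card E);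
           outcome = sparse_generalized_sort c PS ord V E (order_oracle xs)
       in measure (measure_spmf outcome)
            {(ys, q). ys = xs \<and> real q \<le> K * (sqrt (m * n) * ln n)}
            \<ge> 1 - C * n powr (- d) \<and>
          (within_query_budget K0 PS \<longrightarrow>
             lossless_spmf outcome \<and>
             (\<forall>(ys, q) \<in> set_spmf outcome. real q \<le> K * (sqrt (m * n) * ln n))))"
proof (rule exI[of _ "1 + d"], intro conjI allI impI)
  show "0 < 1 + d" using assms by simp
  fix c K0 C0 :: real assume c_ge: "1 + d \<le> c"
  show "\<exists>K C.
    \<forall>(PS :: 'v prediction_alg) V E xs ord.
      prediction_sort d K0 C0 PS \<longrightarrow>
      sorting_instance V E xs \<longrightarrow>
      is_avg_rank_order V ord \<longrightarrow>
      (let n = real (card V);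
           m = real (card E);
           outcome = sparse_generalized_sort c PS ord V E (order_oracle xs)
       in measure (measure_spmf outcome)
            {(ys, q). ys = xs \<and> real q \<le> K * (sqrt (m * n) * ln n)}
            \<ge> 1 - C * n powr (- d) \<and>
          (within_query_budget K0 PS \<longrightarrow>
             lossless_spmf outcome \<and>
             (\<forall>(ys, q) \<in> set_spmf outcome. real q \<le> K * (sqrt (m * n) * ln n))))"
  proof (rule exI[of _ "5 * (3 + c) + 3 * \<bar>K0\<bar>"], rule exI[of _ "5 + \<bar>C0\<bar>"], intro allI impI)
    fix PS :: "'v prediction_alg" and V :: "'v set" and E xs ord
    assume "prediction_sort d K0 C0 PS" "sorting_instance V E xs" "is_avg_rank_order V ord"
    then interpret sparse_sort V E xs c d K0 C0 PS ord
      using assms c_ge by unfold_locales auto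
    have "sparse_generalized_sort c PS ord V E (order_oracle xs) = rounds {}"
      by (simp add: sparse_generalized_sort_def rounds_def)
    then show "let n = real (card V);
           m = real (card E);
           outcome = sparse_generalized_sort c PS ord V E (order_oracle xs)
       in measure (measure_spmf outcome)
            {(ys, q). ys = xs \<and> real q \<le> (5 * (3 + c) + 3 * \<bar>K0\<bar>) * (sqrt (m * n) * ln n)}
            \<ge> 1 - (5 + \<bar>C0\<bar>) * n powr (- d) \<and>
          (within_query_budget K0 PS \<longrightarrow>
             lossless_spmf outcome \<and>
             (\<forall>(ys, q) \<in> set_spmf outcome. real q \<le> (5 * (3 + c) + 3 * \<bar>K0\<bar>) * (sqrt (m * n) * ln n)))"
      using sparse_generalized_sort_correct[OF c_ge] sparse_generalized_sort_budget
      by (auto simp: Let_def n_def m_def w_def)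
  qed
qed

end
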